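(* Let $r,s\in\mathbb Z_{\ge 0}$ and $n'\in\mathbb N$. Let $\{\phi_j\}_{j=1}^{n'}$ and $\{\psi_j\}_{j=1}^{n'}$ be holomorphic functions of $z=(z_1,\ldots,z_{r+s})\in\mathbb C^{r+s}$ near the origin, and let $H(z,\bar z)$ be a complex-valued real-analytic function (near the origin) such that $$\sum_{j=1}^{n'}\phi_j(z)\overline{\psi_j(z)}=\|z\|_{r,s}^2\,H(z,\bar z).$$ If $r+s\le n'\le 2(r+s)-3$ and $H(z,\bar z)\not\equiv 0$, then there exist holomorphic functions $h_1(z)$ and $h_2(z)$ such that $H(z,\bar z)=h_1(z)\overline{h_2(z)}$. Moreover, setting $q=n'-r-s$, there exist holomorphic functions $\{\Phi_i\}_{i=1}^q$, $\{\Psi_i\}_{i=1}^q$ and matrices $B,C$ (complex, of size $n'\times n'$) satisfying $\overline{C}^{T}B=H_{r,s,q}$ such that $$[\phi_1,\ldots,\phi_{n'}]^T=B\,[h_1(z)z_1,\ldots,h_1(z)z_{r+s},\Phi_1,\ldots,\Phi_q]^T,$$ $$[\psi_1,\ldots,\psi_{n'}]^T=C\,[h_2(z)z_1,\ldots,h_2(z)z_{r+s},\Psi_1,\ldots,\Psi_q]^T.$$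
   Context: For $z\in\mathbb C^{r+s}$, $\|z\|_{r,s}^2:=|z_1|^2+\cdots+|z_r|^2-|z_{r+1}|^2-\cdots-|z_{r+s}|^2$. For non-negative integers $r,s,q$, $H_{r,s,q}$ denotes the $(r+s+q)\times(r+s+q)$ diagonal matrix whose diagonal entries are $r$ ones, followed by $s$ entries equal to $-1$, followed by $q$ zeros. *)

theory Defs
  imports "HOL-Analysis.Analysis" "Jordan_Normal_Form.Matrix"
begin

no_notation vec_index (infixl "$" 100)

text \<open>
  Holomorphy in several variables: the Frechet derivative exists at every point and is
  complex-linear. Meant for open sets.
\<close>

definition mv_holomorphic_on :: "(complex ^ 'n::finite \<Rightarrow> complex) \<Rightarrow> (complex ^ 'n) set \<Rightarrow> bool"
  where "mv_holomorphic_on f S \<longleftrightarrow>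
    (\<forall>z\<in>S. \<exists>D. (f has_derivative D) (at z) \<and> (\<forall>a v. D (a *s v) = a * D v))"

definition mv_holomorphic_near :: "complex ^ 'n::finite \<Rightarrow> (complex ^ 'n \<Rightarrow> complex) \<Rightarrow> bool"
  where "mv_holomorphic_near p f \<longleftrightarrow> (\<exists>U. open U \<and> p \<in> U \<and> mv_holomorphic_on f U)"

text \<open>
  Real-analyticity: around every point the function is the sum of a power series in the real
  coordinates with respect to \<^const>\<open>Basis\<close>. A multi-index is an (extensional) function from
  \<^const>\<open>Basis\<close> to the naturals. On \<^typ>\<open>complex ^ 'n\<close> these coordinates are the real and
  imaginary parts of the components.
\<close>

definition real_analytic_on :: "('a::euclidean_space \<Rightarrow> 'b::real_normed_vector) \<Rightarrow> 'a set \<Rightarrow> bool"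
  where "real_analytic_on f S \<longleftrightarrow>
    (\<forall>p\<in>S. \<exists>c. \<exists>\<epsilon>>0. \<forall>x\<in>ball p \<epsilon>.
      ((\<lambda>\<alpha>. (\<Prod>b\<in>Basis. ((x - p) \<bullet> b) ^ \<alpha> b) *\<^sub>R c \<alpha>) has_sum f x) (Basis \<rightarrow>\<^sub>E UNIV))"

definition real_analytic_near :: "'a::euclidean_space \<Rightarrow> ('a \<Rightarrow> 'b::real_normed_vector) \<Rightarrow> bool"
  where "real_analytic_near p f \<longleftrightarrow> (\<exists>U. open U \<and> p \<in> U \<and> real_analytic_on f U)"

text \<open>
  The index type of \<^typ>\<open>complex ^ 'n\<close> carries no order, so \<open>e\<close> enumerates the coordinates
  (counting from 0): the component \<open>z $ e j\<close> is the (j+1)-st coordinate of \<open>z\<close>.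
\<close>

definition sq_norm_rs :: "(nat \<Rightarrow> 'n::finite) \<Rightarrow> nat \<Rightarrow> nat \<Rightarrow> complex ^ 'n \<Rightarrow> real"
  where "sq_norm_rs e r s z =
    (\<Sum>j<r. (cmod (z $ e j))\<^sup>2) - (\<Sum>j = r..<r + s. (cmod (z $ e j))\<^sup>2)"

definition H_mat :: "nat \<Rightarrow> nat \<Rightarrow> nat \<Rightarrow> complex mat"
  where "H_mat r s q = mat (r + s + q) (r + s + q)
    (\<lambda>(i, j). if i \<noteq> j then 0 else if i < r then 1 else if i < r + s then - 1 else 0)"

text \<open>The column \<open>[h(z) z\<^sub>1, \<dots>, h(z) z\<^sub>m, F\<^sub>1(z), \<dots>, F\<^sub>q(z)]\<^sup>T\<close>.\<close>

definition stacked_vec :: "(nat \<Rightarrow> 'n::finite) \<Rightarrow> nat \<Rightarrow> nat \<Rightarrow> (complex ^ 'n \<Rightarrow> complex) \<Rightarrow>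
    (nat \<Rightarrow> complex ^ 'n \<Rightarrow> complex) \<Rightarrow> complex ^ 'n \<Rightarrow> complex Matrix.vec"
  where "stacked_vec e m q h F z =
    Matrix.vec (m + q) (\<lambda>i. if i < m then h z * (z $ e i) else F (i - m) z)"

end

theory Submission
  imports Defs "HOL-Complex_Analysis.Complex_Analysis"
begin


text \<open>Write m for r + s and N for the number n' of functions. Polarisation replaces conj(z) by
  an independent variable, and the signs are absorbed into that variable; the hypothesis then reads
  A(z, w) = sum_j phi_j(z) theta_j(w) = <z, w> H(z, w), with a bilinear pairing and everything
  holomorphic (\<open>polarisation\<close>, \<open>polarised_identity\<close>,
  \<open>hermitian_factorisation\<close>). For fixed w, A(., w) lies in the span of the N functions
  phi_j and vanishes on the hyperplane orthogonal to w.

  The heart is \<open>rank_one\<close>: for N <= 2m - 3 all 2x2 minors of H vanish. Otherwise the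
  span of the phi_j would be too large. Cutting a subspace by a generic hyperplane lowers its
  dimension by one, and one finds two elements of the span that vanish on the section but are
  independent on the subspace. If H vanishes wherever the pairing does, A has a double zero there,
  and A(., g) together with a derivative of A(., g) in its parameter serve; this gives 2m - 1
  independent functions (\<open>indep_on_if_vanishing\<close>) unless A, and hence H, is zero. If H
  does not vanish there, suppose a minor with parameters w, f and with z, z' orthogonal to w is
  nonzero. Inside the hyperplane orthogonal to w the functions A(., f) and A(., w + s f) serve,
  giving 2m - 3 (\<open>indep_on_if_wminor\<close>), and A(., w) is one more. Both counts exceed N.
  Hence such minors vanish, and \<open>minor_vanishes\<close> extends this to all minors.

  Rank one gives H(z, conj z) = h1(z) conj(h2(z)). The rest is linear algebra. Let V relate x to y
  if y pairs with every psi(w) as x pairs with h2(w) w, and let V' be the relation compatible with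
  V. Then phi(z) is a V-lift of h1(z) z, and psi(z) a V'-lift of h2(z) z. The columns of B and C are
  lifts of the standard basis, followed by lifts of 0 (\<open>adapted_columns\<close>);
  compatibility of V and V' says exactly that conj(C)^T B is the diagonal matrix. What remains of
  phi(z) after subtracting its first m columns is a lift of 0, and its coefficients are entries of
  itself, hence holomorphic (\<open>column_representation\<close>).\<close>

no_notation Matrix.scalar_prod (infix "\<bullet>" 70)

section \<open>Zeros of holomorphic functions of one variable\<close>

lemma holomorphic_nonzero_near:
  assumes "f holomorphic_on T" "open T" "connected T"
    and "t\<^sub>1 \<in> T" "f t\<^sub>1 \<noteq> 0" "t\<^sub>0 \<in> T" "\<delta> > 0"
  obtains t where "t \<in> T" "t \<noteq> t\<^sub>0" "dist t t\<^sub>0 < \<delta>" "f t \<noteq> 0"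
proof -
  define U where "U = T \<inter> ball t\<^sub>0 \<delta> - {t\<^sub>0}"
  have "open (T \<inter> ball t\<^sub>0 \<delta>)" "t\<^sub>0 \<in> T \<inter> ball t\<^sub>0 \<delta>"
    using assms by auto
  then have "t\<^sub>0 islimpt U"
    unfolding U_def by (metis interior_limit_point interior_open islimpt_punctured)
  then have "\<exists>t\<in>U. f t \<noteq> 0"
    using analytic_continuation[OF assms(1-3), of U t\<^sub>0 t\<^sub>1] assms U_def by blast
  then show ?thesis
    using that unfolding U_def by (metis DiffE IntD1 IntD2 dist_commute mem_ball singletonI)
qed

text \<open>The function f stays nonzero on a disc, and by the identity theorem g cannot vanish on a
  whole disc. This is how two generic conditions are met at one parameter throughout the
  proof.\<close>

lemma holomorphic_joint_nonzero:
  assumes "f holomorphic_on T" "g holomorphic_on T" "open T" "connected T"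
    and "t\<^sub>0 \<in> T" "f t\<^sub>0 \<noteq> 0" "t\<^sub>1 \<in> T" "g t\<^sub>1 \<noteq> 0"
  obtains t where "t \<in> T" "f t \<noteq> 0" "g t \<noteq> 0"
proof -
  have "isCont f t\<^sub>0"
    using assms(1,3,5) holomorphic_on_imp_continuous_on continuous_on_eq_continuous_at by blast
  then obtain \<delta> where "\<delta> > 0" and \<delta>: "\<And>t. dist t t\<^sub>0 < \<delta> \<Longrightarrow> f t \<noteq> 0"
    using continuous_at_avoid[of t\<^sub>0 f 0] assms(6) by (auto simp: dist_commute)
  then show ?thesis
    using holomorphic_nonzero_near[OF assms(2-4,7,8,5)] that by metis
qed

text \<open>If the Wronskian vanished identically, \<alpha> / \<beta> would be constant near the
  zero of \<alpha>, hence 0 there; by the identity theorem \<alpha> would vanish on all of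
  T.\<close>

lemma wronskian_nonzero:
  assumes "\<alpha> holomorphic_on T" "\<beta> holomorphic_on T" "open T" "connected T"
    and "t\<^sub>0 \<in> T" "\<alpha> t\<^sub>0 = 0" "\<beta> t\<^sub>0 \<noteq> 0" "t\<^sub>1 \<in> T" "\<alpha> t\<^sub>1 \<noteq> 0"
  obtains t where "t \<in> T" "\<alpha> t * deriv \<beta> t - deriv \<alpha> t * \<beta> t \<noteq> 0"
proof -
  have False if W: "\<And>t. t \<in> T \<Longrightarrow> \<alpha> t * deriv \<beta> t - deriv \<alpha> t * \<beta> t = 0"
  proof -
    have "isCont \<beta> t\<^sub>0"
      using assms(2,3,5) holomorphic_on_imp_continuous_on continuous_on_eq_continuous_at by blast
    then obtain d where "d > 0" and d: "\<And>t. dist t\<^sub>0 t < d \<Longrightarrow> \<beta> t \<noteq> 0"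
      using continuous_at_avoid[of t\<^sub>0 \<beta> 0] assms(7) by blast
    obtain \<epsilon> where \<epsilon>: "\<epsilon> > 0" "ball t\<^sub>0 \<epsilon> \<subseteq> T"
      using assms(3,5) openE by blast
    define r where "r = min d \<epsilon>"
    have r: "r > 0" "ball t\<^sub>0 r \<subseteq> T" "\<And>t. t \<in> ball t\<^sub>0 r \<Longrightarrow> \<beta> t \<noteq> 0"
      using \<open>d > 0\<close> \<epsilon> d by (auto simp: r_def)
    have "((\<lambda>t. \<alpha> t / \<beta> t) has_field_derivative 0) (at t within ball t\<^sub>0 r)" if "t \<in> ball t\<^sub>0 r" for t
    proof -
      have t: "t \<in> T" using that r by blast
      have "(\<alpha> has_field_derivative deriv \<alpha> t) (at t within ball t\<^sub>0 r)"
        "(\<beta> has_field_derivative deriv \<beta> t) (at t within ball t\<^sub>0 r)"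
        using assms(1-3) t holomorphic_derivI by blast+
      from DERIV_divide[OF this] show ?thesis
        using W[OF t] r(3)[OF that] by (simp add: algebra_simps)
    qed
    then obtain c where c: "\<And>t. t \<in> ball t\<^sub>0 r \<Longrightarrow> \<alpha> t / \<beta> t = c"
      using has_field_derivative_zero_constant[of "ball t\<^sub>0 r" "\<lambda>t. \<alpha> t / \<beta> t"] by auto
    have "c = 0" using c[of t\<^sub>0] r assms(6) by simp
    then have "\<alpha> t = 0" if "t \<in> ball t\<^sub>0 r" for t using c[OF that] r(3)[OF that] by simp
    then have "\<alpha> t = 0" if "t \<in> T" "dist t t\<^sub>0 < r" for t
      using that by (simp add: dist_commute)
    then show False
      using holomorphic_nonzero_near[OF assms(1,3,4,8,9,5) \<open>r > 0\<close>] by metis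
  qed
  then show ?thesis using that by blast
qed

section \<open>The bilinear pairing and complex lines in a ball\<close>

definition bilin :: "complex ^ 'n::finite \<Rightarrow> complex ^ 'n \<Rightarrow> complex"
  where "bilin z \<zeta> = (\<Sum>i\<in>UNIV. z $ i * \<zeta> $ i)"

lemma bilin_add [simp]: "bilin (x + y) f = bilin x f + bilin y f" "bilin x (f + g) = bilin x f + bilin x g"
  by (simp_all add: bilin_def algebra_simps sum.distrib)

lemma bilin_diff [simp]: "bilin (x - y) f = bilin x f - bilin y f" "bilin x (f - g) = bilin x f - bilin x g"
  by (simp_all add: bilin_def algebra_simps sum_subtractf)

lemma bilin_scale [simp]: "bilin (c *s x) f = c * bilin x f" "bilin x (c *s f) = c * bilin x f"
  by (simp_all add: bilin_def algebra_simps sum_distrib_left)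

lemma bilin_zero [simp]: "bilin 0 f = 0" "bilin x 0 = 0"
  by (simp_all add: bilin_def)

lemma norm_vector_smult_complex [simp]: "norm (c *s x) = cmod c * norm (x :: complex ^ 'n::finite)"
  by (simp add: norm_vec_def norm_mult L2_set_right_distrib)

lemma scaleR_eq_vector_smult: "r *\<^sub>R x = complex_of_real r *s (x :: complex ^ 'n::finite)"
  unfolding Finite_Cartesian_Product.vec_eq_iff vector_scaleR_component vector_smult_component
  by (simp add: scaleR_conv_of_real)

lemma has_derivative_line:
  "((\<lambda>t. a + t *s b) has_derivative (\<lambda>t. t *s b)) (at t within T)" for b :: "complex ^ 'n::finite"
proof -
  have "bounded_linear (\<lambda>t. t *s b)"
    by (rule bounded_linear_intro[where K = "norm b"])
      (auto simp: scaleR_eq_vector_smult vec.scale_left_distrib scaleR_conv_of_real[of _ "_ :: complex"])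
  then show ?thesis
    by (auto intro!: derivative_eq_intros bounded_linear_imp_has_derivative)
qed

lemma continuous_line: "continuous_on T (\<lambda>t. a + t *s b)" for b :: "complex ^ 'n::finite"
  by (rule has_derivative_continuous_on[OF has_derivative_line])

text \<open>The parameters for which a complex line is inside the ball. The set is open and convex,
  so finite intersections of such sets are connected and the one-variable identity theorem applies
  to them.\<close>

definition line_dom :: "real \<Rightarrow> complex ^ 'n::finite \<Rightarrow> complex ^ 'n \<Rightarrow> complex set"
  where "line_dom R a b = {t. a + t *s b \<in> ball 0 R}"

lemma open_line_dom: "open (line_dom R a b)"
proof -
  have "open ((\<lambda>t. a + t *s b) -` ball 0 R)"
    by (rule open_vimage[OF _ continuous_line]) simp
  then show ?thesis by (simp add: line_dom_def vimage_def)
qed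

lemma convex_line_dom: "convex (line_dom R a b)"
proof (rule convexI)
  fix x y :: complex and u v :: real
  assume *: "x \<in> line_dom R a b" "y \<in> line_dom R a b" "0 \<le> u" "0 \<le> v" "u + v = 1"
  have "u *\<^sub>R (a + x *s b) + v *\<^sub>R (a + y *s b) \<in> ball 0 R"
    using * by (intro convexD[OF convex_ball]) (auto simp: line_dom_def)
  also have "u *\<^sub>R (a + x *s b) + v *\<^sub>R (a + y *s b) = (u + v) *\<^sub>R a + (u *\<^sub>R x + v *\<^sub>R y) *s b"
    by (simp add: Finite_Cartesian_Product.vec_eq_iff algebra_simps)
  finally show "u *\<^sub>R x + v *\<^sub>R y \<in> line_dom R a b"
    using * by (simp add: line_dom_def)
qed

text \<open>Take the component of p orthogonal to V and conjugate it, since the pairing is bilinear;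
  then scale it into the ball.\<close>

lemma separate_from_subspace:
  fixes p :: "complex ^ 'n::finite"
  assumes "vec.subspace V" "p \<notin> V" "R > 0"
  obtains f where "f \<in> ball 0 R" "\<And>x. x \<in> V \<Longrightarrow> bilin x f = 0" "bilin p f \<noteq> 0"
proof -
  have "subspace V"
    using assms(1) by (auto simp: subspace_def vec.subspace_def scaleR_eq_vector_smult)
  obtain x w where xw: "x \<in> span V" "\<And>v. v \<in> span V \<Longrightarrow> real_inner_class.orthogonal w v" "p = x + w"
    using orthogonal_subspace_decomp_exists[of V p] by metis
  have sV: "span V = V" using \<open>subspace V\<close> by (simp add: span_eq_iff)
  define g where "g = (\<chi> i. cnj (w $ i))"
  have re: "Re (bilin v g) = inner w v" for v
    by (simp add: bilin_def g_def inner_vec_def inner_complex_def mult.commute)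
  have g0: "bilin v g = 0" if "v \<in> V" for v
  proof -
    have "Re (bilin v g) = 0" using re xw(2) that by (simp add: sV real_inner_class.orthogonal_def)
    \<comment> \<open>V is a complex subspace, so real orthogonality to \<i> v as well as to v kills
      the imaginary part of the pairing.\<close>
    moreover have "Re (bilin (\<i> *s v) g) = 0"
      unfolding re using xw(2)[of "\<i> *s v"] that assms(1) by (simp add: sV real_inner_class.orthogonal_def vec.subspace_def)
    ultimately show ?thesis by (simp add: complex_eq_iff)
  qed
  have "w \<noteq> 0" using xw assms(2) sV by auto
  then have "Re (bilin p g) \<noteq> 0"
    using re[of p] xw(2)[of x] xw(1) by (simp add: xw(3) inner_add_right real_inner_class.orthogonal_def)
  then have gp: "bilin p g \<noteq> 0" by auto
  define c where "c = R / (2 * (norm g + 1))"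
  have pos: "norm g + 1 > 0" by (simp add: add_nonneg_pos)
  then have "c > 0" using assms(3) by (simp add: c_def)
  moreover have "c * norm g \<le> c * (norm g + 1)" using \<open>c > 0\<close> by simp
  moreover have "c * (norm g + 1) = R / 2"
    using pos unfolding c_def by (metis less_numeral_extra(3) nonzero_mult_divide_mult_cancel_right
        times_divide_eq_left)
  ultimately have c: "c > 0" "c * norm g < R" using assms(3) by auto
  show ?thesis
    by (rule that[of "complex_of_real c *s g"]) (use c g0 gp in auto)
qed

lemma dim_kernel_ge:
  fixes S :: "(complex ^ 'n::finite) set"
  assumes "vec.subspace S"
  shows "vec.dim S \<le> Suc (vec.dim (S \<inter> {x. bilin x f = 0}))"
proof (cases "\<exists>p\<in>S. bilin p f \<noteq> 0")
  case True
  then obtain p where p: "p \<in> S" "bilin p f \<noteq> 0" by blast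
  have "S \<subseteq> vec.span (insert p (S \<inter> {x. bilin x f = 0}))"
  proof
    fix x assume x: "x \<in> S"
    define c where "c = bilin x f / bilin p f"
    have "x - c *s p \<in> S \<inter> {x. bilin x f = 0}"
      using x p assms by (auto simp: c_def vec.subspace_diff vec.subspace_scale)
    then show "x \<in> vec.span (insert p (S \<inter> {x. bilin x f = 0}))"
      by (metis vec.span_base vec.span_breakdown_eq)
  qed
  then have "vec.dim S \<le> vec.dim (insert p (S \<inter> {x. bilin x f = 0}))"
    by (metis vec.dim_span vec.dim_subset)
  then show ?thesis by (simp add: vec.dim_insert split: if_splits)
next
  case False
  then have "S \<inter> {x. bilin x f = 0} = S" by auto
  then show ?thesis by simp
qed

lemma subspace_kernel: "vec.subspace S \<Longrightarrow> vec.subspace (S \<inter> {x. bilin x f = 0})"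
  by (auto simp: vec.subspace_def)

lemma exists_outside_span:
  fixes S :: "(complex ^ 'n::finite) set"
  assumes "finite B" "card B < vec.dim S"
  obtains p where "p \<in> S" "p \<notin> vec.span B"
  using vec.dim_le_card[of S B] assms by force


section \<open>Kernels divisible by the bilinear form\<close>

lemma overdetermined_dependent:
  fixes g :: "nat \<Rightarrow> nat \<Rightarrow> 'a::field"
  assumes "n < k"
  shows "\<exists>b. (\<exists>i<k. b i \<noteq> 0) \<and> (\<forall>j<n. (\<Sum>i<k. b i * g i j) = 0)"
  using assms
proof (induction n arbitrary: k g)
  case 0
  then show ?case by (intro exI[of _ "\<lambda>_. 1"]) auto
next
  case (Suc n)
  then obtain k' where k: "k = Suc k'" "n < k'" by (cases k) auto
  show ?case
  proof (cases "\<exists>p<k. g p n \<noteq> 0")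
    case False
    have "n < k" using Suc.prems by simp
    from Suc.IH[OF this, of g] obtain b
      where b: "\<exists>i<k. b i \<noteq> 0" "\<forall>j<n. (\<Sum>i<k. b i * g i j) = 0"
      by blast
    moreover have "(\<Sum>i<k. b i * g i n) = 0"
      using False by (intro sum.neutral) simp
    ultimately show ?thesis by (auto simp: less_Suc_eq)
  next
    case True
    then obtain p where p: "p < k" "g p n \<noteq> 0" by blast
    \<comment> \<open>One step of Gaussian elimination with pivot row p: \<open>s\<close> enumerates
      the other rows, skipping p.\<close>
    define s where "s = (\<lambda>i. if i < p then i else Suc i)"
    define c where "c = (\<lambda>i. g (s i) n / g p n)"
    from Suc.IH[OF k(2), of "\<lambda>i j. g (s i) j - c i * g p j"] obtain b
      where b: "\<exists>i<k'. b i \<noteq> 0" "\<forall>j<n. (\<Sum>i<k'. b i * (g (s i) j - c i * g p j)) = 0"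
      by blast
    define b' where "b' = (\<lambda>i. if i = p then - (\<Sum>l<k'. b l * c l) else b (if i < p then i else i - 1))"
    have bij: "bij_betw s {..<k'} ({..<k} - {p})"
      by (rule bij_betw_byWitness[where f' = "\<lambda>i. if i < p then i else i - 1"])
        (use p k in \<open>auto simp: s_def split: if_splits\<close>)
    have bs: "b' (s i) = b i" "s i \<noteq> p" for i
      by (auto simp: b'_def s_def)
    have sum: "(\<Sum>i<k. b' i * g i j) = (\<Sum>i<k'. b i * (g (s i) j - c i * g p j))" for j
    proof -
      have "(\<Sum>i<k. b' i * g i j) = b' p * g p j + (\<Sum>i\<in>{..<k} - {p}. b' i * g i j)"
        using p by (simp add: sum.remove)
      also have "(\<Sum>i\<in>{..<k} - {p}. b' i * g i j) = (\<Sum>i<k'. b i * g (s i) j)"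
        by (subst sum.reindex_bij_betw[OF bij, symmetric]) (simp add: bs)
      also have "b' p * g p j = - (\<Sum>i<k'. b i * (c i * g p j))"
        by (simp add: b'_def sum_distrib_right mult.assoc)
      finally show ?thesis by (simp add: right_diff_distrib sum_subtractf)
    qed
    show ?thesis
    proof (intro exI[of _ b'] conjI allI impI)
      obtain i where "i < k'" "b i \<noteq> 0" using b by blast
      then show "\<exists>i<k. b' i \<noteq> 0" using bs(1)[of i] bij
        by (metis Diff_iff bij_betwE lessThan_iff)
    next
      fix j assume "j < Suc n"
      then show "(\<Sum>i<k. b' i * g i j) = 0"
        using b(2) p by (cases "j = n") (simp_all add: sum c_def)
    qed
  qed
qed

text \<open>Holomorphy is asked only along complex lines, which is all that the identity theorem
  needs. For H the two arguments may move at once with a common parameter.\<close>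

locale holomorphic_kernel =
  fixes R :: real and N :: nat
    and \<phi> \<theta> :: "nat \<Rightarrow> complex ^ 'n::finite \<Rightarrow> complex"
    and H :: "complex ^ 'n \<Rightarrow> complex ^ 'n \<Rightarrow> complex"
  assumes R_pos: "R > 0"
    and \<phi>_line: "\<And>j a b. j < N \<Longrightarrow> (\<lambda>t. \<phi> j (a + t *s b)) holomorphic_on line_dom R a b"
    and \<theta>_line: "\<And>j a b. j < N \<Longrightarrow> (\<lambda>t. \<theta> j (a + t *s b)) holomorphic_on line_dom R a b"
    and H_line: "\<And>a b c d. (\<lambda>t. H (a + t *s b) (c + t *s d)) holomorphic_on line_dom R a b \<inter> line_dom R c d"
    and kernel: "\<And>z \<zeta>. z \<in> ball 0 R \<Longrightarrow> \<zeta> \<in> ball 0 R \<Longrightarrow>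
      (\<Sum>j<N. \<phi> j z * \<theta> j \<zeta>) = bilin z \<zeta> * H z \<zeta>"
begin

abbreviation \<B> where "\<B> \<equiv> ball (0 :: complex ^ 'n) R"

definition ev :: "(nat \<Rightarrow> complex) \<Rightarrow> complex ^ 'n \<Rightarrow> complex"
  where "ev u z = (\<Sum>j<N. u j * \<phi> j z)"

definition A :: "complex ^ 'n \<Rightarrow> complex ^ 'n \<Rightarrow> complex"
  where "A z \<zeta> = ev (\<lambda>j. \<theta> j \<zeta>) z"

lemma A_eq: "z \<in> \<B> \<Longrightarrow> \<zeta> \<in> \<B> \<Longrightarrow> A z \<zeta> = bilin z \<zeta> * H z \<zeta>"
  using kernel by (simp add: A_def ev_def mult.commute)

lemma H_holo [holomorphic_intros]:
  assumes "T \<subseteq> line_dom R a b" "T \<subseteq> line_dom R c d"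
  shows "(\<lambda>t. H (a + t *s b) (c + t *s d)) holomorphic_on T"
  using H_line assms by (meson holomorphic_on_subset le_inf_iff)

lemma H_holo_left [holomorphic_intros]:
  assumes "T \<subseteq> line_dom R a b" "\<zeta> \<in> \<B>"
  shows "(\<lambda>t. H (a + t *s b) \<zeta>) holomorphic_on T"
  using H_holo[of T a b \<zeta> 0] assms by (auto simp: line_dom_def)

lemma H_holo_right [holomorphic_intros]:
  assumes "T \<subseteq> line_dom R c d" "z \<in> \<B>"
  shows "(\<lambda>t. H z (c + t *s d)) holomorphic_on T"
  using H_holo[of T z 0 c d] assms by (auto simp: line_dom_def)

lemma \<theta>_holo: "j < N \<Longrightarrow> T \<subseteq> line_dom R a b \<Longrightarrow> (\<lambda>t. \<theta> j (a + t *s b)) holomorphic_on T"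
  using \<theta>_line holomorphic_on_subset by blast

lemma A_holo_left [holomorphic_intros]:
  assumes "T \<subseteq> line_dom R a b"
  shows "(\<lambda>t. A (a + t *s b) \<zeta>) holomorphic_on T"
  unfolding A_def ev_def
  by (intro holomorphic_intros holomorphic_on_subset[OF \<phi>_line assms]) auto

lemma A_holo_right [holomorphic_intros]:
  assumes "T \<subseteq> line_dom R c d"
  shows "(\<lambda>t. A z (c + t *s d)) holomorphic_on T"
  unfolding A_def ev_def
  by (intro holomorphic_intros \<theta>_holo assms) auto

text \<open>Says that the span of the \<phi> j, restricted to S within the ball, has dimension at
  least k. The lower bounds below are played off against the upper bound N.\<close>

definition indep_on :: "(complex ^ 'n) set \<Rightarrow> nat \<Rightarrow> bool"
  where "indep_on S k \<longleftrightarrow> (\<exists>g. \<forall>b. (\<forall>z\<in>S \<inter> \<B>. (\<Sum>i<k. b i * ev (g i) z) = 0) \<longrightarrow> (\<forall>i<k. b i = 0))"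

lemma indep_on_le: "indep_on S k \<Longrightarrow> k \<le> N"
proof (rule ccontr)
  assume "indep_on S k" "\<not> k \<le> N"
  then obtain g where g: "\<And>b. (\<forall>z\<in>S \<inter> \<B>. (\<Sum>i<k. b i * ev (g i) z) = 0) \<Longrightarrow> \<forall>i<k. b i = 0"
    by (auto simp: indep_on_def)
  obtain b where b: "\<exists>i<k. b i \<noteq> 0" "\<And>j. j < N \<Longrightarrow> (\<Sum>i<k. b i * g i j) = 0"
    using overdetermined_dependent[of N k g] \<open>\<not> k \<le> N\<close> by (meson not_le)
  have "(\<Sum>i<k. b i * ev (g i) z) = (\<Sum>j<N. (\<Sum>i<k. b i * g i j) * \<phi> j z)" for z
    unfolding ev_def sum_distrib_left sum_distrib_right
    by (subst sum.swap) (simp add: mult.assoc)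
  then have "(\<Sum>i<k. b i * ev (g i) z) = 0" for z
    using b(2) by simp
  then show False using g b(1) by blast
qed

lemma indep_on_0 [simp]: "indep_on S 0"
  by (simp add: indep_on_def)

text \<open>On S' a linear relation loses its u-term, so the first k coefficients vanish; evaluation
  at z then removes the last one.\<close>

lemma indep_on_Suc:
  assumes "indep_on S' k" "S' \<subseteq> S"
    and "\<And>x. x \<in> S' \<inter> \<B> \<Longrightarrow> ev u x = 0"
    and "z \<in> S \<inter> \<B>" "ev u z \<noteq> 0"
  shows "indep_on S (Suc k)"
proof -
  obtain g where g: "\<And>b. (\<forall>z\<in>S' \<inter> \<B>. (\<Sum>i<k. b i * ev (g i) z) = 0) \<Longrightarrow> \<forall>i<k. b i = 0"
    using assms(1) by (auto simp: indep_on_def)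
  define g' where "g' = g(k := u)"
  have "\<forall>i<Suc k. b i = 0" if b: "\<forall>z\<in>S \<inter> \<B>. (\<Sum>i<Suc k. b i * ev (g' i) z) = 0" for b
  proof -
    have sum: "(\<Sum>i<Suc k. b i * ev (g' i) x) = (\<Sum>i<k. b i * ev (g i) x) + b k * ev u x" for x
      by (simp add: g'_def)
    have "\<forall>i<k. b i = 0"
    proof (intro g ballI)
      fix x assume x: "x \<in> S' \<inter> \<B>"
      then have "x \<in> S \<inter> \<B>" using assms(2) by blast
      with b have "(\<Sum>i<Suc k. b i * ev (g' i) x) = 0" by blast
      then show "(\<Sum>i<k. b i * ev (g i) x) = 0" unfolding sum using assms(3)[OF x] by simp
    qed
    moreover have "b k = 0"
    proof -
      have "(\<Sum>i<Suc k. b i * ev (g' i) z) = 0" using b assms(4) by blast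
      then show ?thesis unfolding sum using calculation assms(5) by simp
    qed
    ultimately show ?thesis by (simp add: less_Suc_eq)
  qed
  then show ?thesis unfolding indep_on_def by blast
qed

text \<open>As for a single function, except that the last two coefficients are removed by Cramer's
  rule at the points z and w.\<close>

lemma indep_on_Suc_Suc:
  assumes "indep_on S' k" "S' \<subseteq> S"
    and "\<And>x. x \<in> S' \<inter> \<B> \<Longrightarrow> ev u x = 0" "\<And>x. x \<in> S' \<inter> \<B> \<Longrightarrow> ev v x = 0"
    and "z \<in> S \<inter> \<B>" "w \<in> S \<inter> \<B>" "ev u z * ev v w - ev u w * ev v z \<noteq> 0"
  shows "indep_on S (Suc (Suc k))"
proof -
  obtain g where g: "\<And>b. (\<forall>z\<in>S' \<inter> \<B>. (\<Sum>i<k. b i * ev (g i) z) = 0) \<Longrightarrow> \<forall>i<k. b i = 0"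
    using assms(1) by (auto simp: indep_on_def)
  define g' where "g' = g(k := u, Suc k := v)"
  have "\<forall>i<Suc (Suc k). b i = 0" if b: "\<forall>z\<in>S \<inter> \<B>. (\<Sum>i<Suc (Suc k). b i * ev (g' i) z) = 0" for b
  proof -
    have sum: "(\<Sum>i<Suc (Suc k). b i * ev (g' i) x) =
        (\<Sum>i<k. b i * ev (g i) x) + b k * ev u x + b (Suc k) * ev v x" for x
      by (simp add: g'_def)
    have bk: "\<forall>i<k. b i = 0"
    proof (intro g ballI)
      fix x assume x: "x \<in> S' \<inter> \<B>"
      then have "x \<in> S \<inter> \<B>" using assms(2) by blast
      with b have "(\<Sum>i<Suc (Suc k). b i * ev (g' i) x) = 0" by blast
      then show "(\<Sum>i<k. b i * ev (g i) x) = 0" unfolding sum using assms(3)[OF x] assms(4)[OF x] by simp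
    qed
    have eq: "b k * ev u x + b (Suc k) * ev v x = 0" if "x \<in> S \<inter> \<B>" for x
    proof -
      have "(\<Sum>i<Suc (Suc k). b i * ev (g' i) x) = 0" using b that by blast
      then show ?thesis unfolding sum using bk by simp
    qed
    have "b k * (ev u z * ev v w - ev u w * ev v z) =
        ev v w * (b k * ev u z + b (Suc k) * ev v z) - ev v z * (b k * ev u w + b (Suc k) * ev v w)"
      by (simp add: algebra_simps)
    then have "b k = 0" using eq assms(5-7) by simp
    have "b (Suc k) * (ev u z * ev v w - ev u w * ev v z) =
        ev u z * (b k * ev u w + b (Suc k) * ev v w) - ev u w * (b k * ev u z + b (Suc k) * ev v z)"
      by (simp add: algebra_simps)
    then have "b (Suc k) = 0" using eq assms(5-7) by simp
    with bk \<open>b k = 0\<close> show ?thesis by (simp add: less_Suc_eq)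
  qed
  then show ?thesis unfolding indep_on_def by blast
qed

text \<open>
  As \<open>f\<close> moves along the line \<open>f\<^sub>0 + t v\<close>, the projection of \<open>y\<close> to \<open>f\<^sup>\<bottom>\<close> along \<open>p\<close>, multiplied by
  \<open>bilin p f\<close>, stays affine in \<open>t\<close>.
\<close>

lemma slice:
  assumes S: "vec.subspace S" and "y \<in> S" "y' \<in> S" "y \<in> \<B>" "y' \<in> \<B>" "p \<in> S"
    and f\<^sub>0: "bilin y f\<^sub>0 = 0" "bilin y' f\<^sub>0 = 0" "bilin p f\<^sub>0 \<noteq> 0"
    and T: "open T" "convex T" "0 \<in> T"
    and w: "w holomorphic_on T" "t\<^sub>1 \<in> T" "w t\<^sub>1 \<noteq> 0"
    and \<kappa>: "\<And>a b a' b'. (\<lambda>t. \<kappa> (a + t *s b) (a' + t *s b')) holomorphic_on line_dom R a b \<inter> line_dom R a' b'"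
    and "\<kappa> y y' \<noteq> (0 :: complex)"
  obtains t x x' where "t \<in> T" "w t \<noteq> 0" "x \<in> S" "x' \<in> S" "x \<in> \<B>" "x' \<in> \<B>"
    "bilin x (f\<^sub>0 + t *s v) = 0" "bilin x' (f\<^sub>0 + t *s v) = 0" "\<kappa> x x' \<noteq> 0"
proof -
  \<comment> \<open>The velocity \<open>c y\<close> is solved for so that
    \<open>y + t *s c y\<close> stays orthogonal to the moving f: the linear term in t cancels
    through p, and the quadratic one vanishes because \<open>bilin (c y) v = 0\<close>.\<close>
  define c where "c = (\<lambda>y. (1 / bilin p f\<^sub>0) *s (bilin p v *s y - bilin y v *s p))"
  have c: "bilin (y + t *s c y) (f\<^sub>0 + t *s v) = 0" if "bilin y f\<^sub>0 = 0" for y t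
    using that f\<^sub>0(3) by (simp add: c_def field_simps)
  have cS: "y + t *s c y \<in> S" if "y \<in> S" for y t
    using that S \<open>p \<in> S\<close> unfolding c_def
    by (intro vec.subspace_add vec.subspace_scale vec.subspace_diff)
  \<comment> \<open>The moved points may leave the ball, so y and y' are first scaled by a small
    nonzero l. The bound by M keeps the scaled points inside at the parameter where w is nonzero; by
    the identity theorem \<kappa> is still nonzero for some such l.\<close>
  define M where "M = 1 + norm (y + t\<^sub>1 *s c y) + norm (y' + t\<^sub>1 *s c y')"
  have M: "M > 0" unfolding M_def by (smt (verit) norm_ge_zero)
  define L where "L = line_dom R 0 y \<inter> line_dom R 0 y'"
  have L: "open L" "convex L" by (auto simp: L_def open_line_dom convex_line_dom convex_Int)
  have "(\<lambda>t. \<kappa> (0 + t *s y) (0 + t *s y')) holomorphic_on L"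
    unfolding L_def by (rule \<kappa>)
  moreover have "1 \<in> L" "0 \<in> L"
    using assms(4,5) R_pos by (auto simp: L_def line_dom_def)
  ultimately obtain l where l: "l \<in> L" "l \<noteq> 0" "dist l 0 < R / M" "\<kappa> (0 + l *s y) (0 + l *s y') \<noteq> 0"
    using holomorphic_nonzero_near[of "\<lambda>t. \<kappa> (0 + t *s y) (0 + t *s y')" L 1 0 "R / M"] L convex_connected
      assms M R_pos by auto
  have lM: "cmod l * M < R" using l(3) M by (simp add: field_simps)
  \<comment> \<open>Q is connected and contains both 0, where \<kappa> is nonzero, and the parameter
    where w is nonzero.\<close>
  define Q where "Q = line_dom R (l *s y) (l *s c y) \<inter> line_dom R (l *s y') (l *s c y') \<inter> T"
  have cl: "l *s y + t *s (l *s c y) = l *s (y + t *s c y)" for y t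
    by (simp add: vec.scale_right_distrib vec.scale_left_commute)
  have ineq: "cmod l * norm (y + t\<^sub>1 *s c y) < R" "cmod l * norm (y' + t\<^sub>1 *s c y') < R"
    by (rule le_less_trans[OF _ lM]; intro mult_left_mono; simp add: M_def)+
  have Q: "open Q" "connected Q" "0 \<in> Q" "t\<^sub>1 \<in> Q"
  proof -
    show "open Q" unfolding Q_def using T by (intro open_Int open_line_dom)
    show "connected Q" unfolding Q_def
      using T by (intro convex_connected convex_Int convex_line_dom)
    show "0 \<in> Q" using T(3) l(1) by (simp add: Q_def L_def line_dom_def)
    have ineq': "norm (l *s (y + t\<^sub>1 *s c y)) < R" "norm (l *s (y' + t\<^sub>1 *s c y')) < R"
      unfolding norm_vector_smult_complex by (rule ineq)+
    show "t\<^sub>1 \<in> Q" using w(2) ineq' unfolding Q_def line_dom_def mem_Collect_eq Int_iff cl mem_ball_0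
      by blast
  qed
  have "(\<lambda>t. \<kappa> (l *s y + t *s (l *s c y)) (l *s y' + t *s (l *s c y'))) holomorphic_on Q"
    by (rule holomorphic_on_subset[OF \<kappa>]) (auto simp: Q_def)
  moreover have "w holomorphic_on Q"
    by (rule holomorphic_on_subset[OF w(1)]) (auto simp: Q_def)
  ultimately obtain t where t: "t \<in> Q" "w t \<noteq> 0"
      "\<kappa> (l *s y + t *s (l *s c y)) (l *s y' + t *s (l *s c y')) \<noteq> 0"
    using holomorphic_joint_nonzero[of "\<lambda>t. \<kappa> (l *s y + t *s (l *s c y)) (l *s y' + t *s (l *s c y'))" Q w 0 t\<^sub>1]
      Q l(4) w(3) by auto
  show ?thesis
  proof (rule that)
    show "t \<in> T" "w t \<noteq> 0" using t by (auto simp: Q_def)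
    show "l *s y + t *s (l *s c y) \<in> S" "l *s y' + t *s (l *s c y') \<in> S"
      unfolding cl by (intro vec.subspace_scale[OF S] cS assms(2,3))+
    show "l *s y + t *s (l *s c y) \<in> \<B>" "l *s y' + t *s (l *s c y') \<in> \<B>"
      using t(1) by (auto simp: Q_def line_dom_def)
    show "bilin (l *s y + t *s (l *s c y)) (f\<^sub>0 + t *s v) = 0" "bilin (l *s y' + t *s (l *s c y')) (f\<^sub>0 + t *s v) = 0"
      unfolding cl bilin_scale(1) using c f\<^sub>0(1,2) by simp_all
  qed (use t in auto)
qed

end


lemma bilin_holo [holomorphic_intros]: "(\<lambda>t. bilin (a + t *s b) (c + t *s d)) holomorphic_on T"
  by (auto intro!: holomorphic_intros)

lemma bilin_holo_left [holomorphic_intros]: "(\<lambda>t. bilin (a + t *s b) c) holomorphic_on T"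
  by (auto intro!: holomorphic_intros)

lemma bilin_holo_right [holomorphic_intros]: "(\<lambda>t. bilin a (c + t *s d)) holomorphic_on T"
  by (auto intro!: holomorphic_intros)

lemma bilin_nondegenerate:
  assumes "f \<noteq> (0 :: complex ^ 'n::finite)"
  obtains p where "bilin p f \<noteq> 0"
proof -
  obtain i where "f $ i \<noteq> 0"
    using assms by (auto simp: Finite_Cartesian_Product.vec_eq_iff)
  moreover have "bilin (axis i 1) f = (\<Sum>j\<in>UNIV. if j = i then f $ j else 0)"
    unfolding bilin_def by (intro sum.cong) (auto simp: axis_def)
  ultimately show ?thesis using that[of "axis i 1"] by simp
qed

lemma line_nonzero_near:
  assumes "f holomorphic_on line_dom R a b" "t\<^sub>1 \<in> line_dom R a b" "f t\<^sub>1 \<noteq> 0"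
    and "t\<^sub>0 \<in> line_dom R a b" "\<delta> > 0"
  shows "\<exists>t\<in>line_dom R a b. t \<noteq> t\<^sub>0 \<and> dist t t\<^sub>0 < \<delta> \<and> f t \<noteq> 0"
  using holomorphic_nonzero_near[OF assms(1) open_line_dom convex_connected[OF convex_line_dom] assms(2-5)]
  by metis

text \<open>Along the line the pairing is a quadratic polynomial in t with leading coefficient
  \<open>bilin b d\<close>, so it is not identically zero.\<close>

lemma perturb_off_incidence:
  assumes "F holomorphic_on T" "open T" "connected T" "0 \<in> T" "F 0 \<noteq> 0" "bilin b d \<noteq> 0"
  obtains t where "t \<in> T" "F t \<noteq> 0" "bilin (a + t *s b) (c + t *s d) \<noteq> 0"
proof -
  have "\<exists>t. bilin (a + t *s b) (c + t *s d) \<noteq> 0"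
  proof (rule ccontr)
    assume "\<not> ?thesis"
    then have *: "bilin (a + t *s b) (c + t *s d) = 0" for t by blast
    \<comment> \<open>The second difference extracts the coefficient of t^2.\<close>
    have "bilin b d = (bilin (a + 1 *s b) (c + 1 *s d) + bilin (a + (-1) *s b) (c + (-1) *s d)) / 2
        - bilin (a + 0 *s b) (c + 0 *s d)"
      by (simp add: field_simps)
    then show False using assms(6) unfolding * by simp
  qed
  then obtain t\<^sub>1 where t\<^sub>1: "bilin (a + t\<^sub>1 *s b) (c + t\<^sub>1 *s d) \<noteq> 0" by blast
  obtain \<delta> where \<delta>: "\<delta> > 0" "ball 0 \<delta> \<subseteq> T" using assms(2,4) openE by blast
  obtain t\<^sub>2 where "dist t\<^sub>2 0 < \<delta>" "bilin (a + t\<^sub>2 *s b) (c + t\<^sub>2 *s d) \<noteq> 0"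
    using holomorphic_nonzero_near[OF bilin_holo[of a b c d UNIV] _ _ _ t\<^sub>1, of 0 \<delta>] \<delta>(1) by auto
  moreover from this have "t\<^sub>2 \<in> T" using \<delta>(2) by auto
  ultimately show ?thesis
    using holomorphic_joint_nonzero[OF assms(1) bilin_holo assms(2-5)] that by blast
qed

section \<open>Lower bounds for the number of independent functions\<close>

context holomorphic_kernel
begin

lemma A_0 [simp]: "z \<in> \<B> \<Longrightarrow> f \<in> \<B> \<Longrightarrow> bilin z f = 0 \<Longrightarrow> A z f = 0"
  by (simp add: A_eq)

lemma indep_on_1:
  assumes "z \<in> S" "z \<in> \<B>" "A z f \<noteq> 0"
  shows "indep_on S (Suc 0)"
  using indep_on_Suc[OF indep_on_0[of "{}"], of S "\<lambda>j. \<theta> j f" z] assms by (simp add: A_def)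

text \<open>Differentiating A in its second variable yields again a linear combination of the \<phi>
  j, so derivatives count towards the dimension of the span.\<close>

lemma ev_deriv:
  assumes "t \<in> line_dom R c d"
  shows "((\<lambda>s. A x (c + s *s d)) has_field_derivative ev (\<lambda>j. deriv (\<lambda>s. \<theta> j (c + s *s d)) t) x) (at t)"
proof -
  have "((\<lambda>s. \<theta> j (c + s *s d)) has_field_derivative deriv (\<lambda>s. \<theta> j (c + s *s d)) t) (at t)" if "j < N" for j
    using \<theta>_line[OF that] assms open_line_dom holomorphic_derivI by blast
  then show ?thesis
    unfolding A_def ev_def by (intro DERIV_sum DERIV_cmult_right) auto
qed

text \<open>
  Here the kernel vanishes to second order along the incidence variety, so that both a value and a
  directional derivative of \<open>\<zeta> \<mapsto> A z \<zeta>\<close> at \<open>f\<close> vanish for \<open>z\<close> in the hyperplane \<open>f\<^sup>\<bottom>\<close>; by the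
  Wronskian they are independent on \<open>S\<close> for a generic \<open>f\<close>.
\<close>

lemma indep_on_if_vanishing:
  assumes inc: "\<And>z \<zeta>. z \<in> \<B> \<Longrightarrow> \<zeta> \<in> \<B> \<Longrightarrow> bilin z \<zeta> = 0 \<Longrightarrow> H z \<zeta> = 0"
    and \<zeta>\<^sub>1: "\<zeta>\<^sub>1 \<in> \<B>"
    and "vec.subspace S" "Suc d \<le> vec.dim S" "z\<^sub>1 \<in> S" "z\<^sub>1 \<in> \<B>" "A z\<^sub>1 \<zeta>\<^sub>1 \<noteq> 0"
  shows "indep_on S (Suc (2 * d))"
  using assms(3-)
proof (induction d arbitrary: S z\<^sub>1)
  case 0
  then show ?case using indep_on_1 by auto
next
  case (Suc d)
  note S = \<open>vec.subspace S\<close>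
  have \<kappa>: "(\<lambda>t. (\<lambda>y _. A y \<zeta>\<^sub>1) (a + t *s b) (a' + t *s b')) holomorphic_on line_dom R a b \<inter> line_dom R a' b'"
    for a b a' b' by (intro holomorphic_intros) auto
  obtain q where q: "q \<in> S" "q \<notin> vec.span {z\<^sub>1}"
    using exists_outside_span[of "{z\<^sub>1}" S] Suc.prems by auto
  obtain f where f: "f \<in> \<B>" "\<And>x. x \<in> vec.span {z\<^sub>1} \<Longrightarrow> bilin x f = 0" "bilin q f \<noteq> 0"
    using separate_from_subspace[OF vec.subspace_span q(2) R_pos] by metis
  have z1f: "bilin z\<^sub>1 f = 0" using f(2) by (simp add: vec.span_base)
  define v where "v = \<zeta>\<^sub>1 - f"
  have ends: "0 \<in> line_dom R f v" "1 \<in> line_dom R f v"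
    using f(1) \<zeta>\<^sub>1 by (auto simp: line_dom_def v_def)
  have "(\<lambda>t. A z\<^sub>1 (f + t *s v)) holomorphic_on line_dom R f v"
    by (intro holomorphic_intros) auto
  moreover have "A z\<^sub>1 (f + 1 *s v) \<noteq> 0" using Suc.prems by (simp add: v_def)
  \<comment> \<open>Slide f from a hyperplane through the given point towards the fixed parameter:
    the given point leaves the hyperplane, but some x in it still has a nonzero value at the fixed
    parameter.\<close>
  ultimately obtain t x where t: "t \<in> line_dom R f v" "A z\<^sub>1 (f + t *s v) \<noteq> 0" "x \<in> S" "x \<in> \<B>"
      "bilin x (f + t *s v) = 0" "A x \<zeta>\<^sub>1 \<noteq> 0"
    using slice[OF S Suc.prems(3,3,4,4) q(1) z1f z1f f(3) open_line_dom convex_line_dom ends(1) _ ends(2) _ \<kappa>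
        Suc.prems(5), of "\<lambda>t. A z\<^sub>1 (f + t *s v)" v] by blast
  define f\<^sub>0 where "f\<^sub>0 = f + t *s v"
  define v\<^sub>0 where "v\<^sub>0 = \<zeta>\<^sub>1 - f\<^sub>0"
  define T where "T = line_dom R f\<^sub>0 v\<^sub>0"
  have f0: "f\<^sub>0 \<in> \<B>" "A z\<^sub>1 f\<^sub>0 \<noteq> 0" "bilin x f\<^sub>0 = 0"
    using t by (auto simp: f\<^sub>0_def line_dom_def)
  \<comment> \<open>Since it is off the hyperplane, this point can serve as the centre of projection
    in the second slide.\<close>
  then have z1f0: "bilin z\<^sub>1 f\<^sub>0 \<noteq> 0" using Suc.prems(4) A_0 by blast
  have T: "open T" "convex T" "0 \<in> T" "1 \<in> T"
    using f0(1) \<zeta>\<^sub>1 unfolding T_def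
    by (simp_all only: open_line_dom convex_line_dom) (simp_all add: line_dom_def v\<^sub>0_def)
  define \<alpha> where "\<alpha> = (\<lambda>s. A x (f\<^sub>0 + s *s v\<^sub>0))"
  define \<beta> where "\<beta> = (\<lambda>s. A z\<^sub>1 (f\<^sub>0 + s *s v\<^sub>0))"
  have holo: "\<alpha> holomorphic_on T" "\<beta> holomorphic_on T"
    unfolding \<alpha>_def \<beta>_def T_def by (intro holomorphic_intros order_refl)+
  have ends: "\<alpha> 0 = 0" "\<beta> 0 \<noteq> 0" "\<alpha> 1 \<noteq> 0"
    using f0 t(4,6) by (auto simp: \<alpha>_def \<beta>_def v\<^sub>0_def)
  obtain t\<^sub>1 where t\<^sub>1: "t\<^sub>1 \<in> T" "\<alpha> t\<^sub>1 * deriv \<beta> t\<^sub>1 - deriv \<alpha> t\<^sub>1 * \<beta> t\<^sub>1 \<noteq> 0"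
    using wronskian_nonzero[OF holo T(1) convex_connected[OF T(2)] T(3) ends(1,2) T(4) ends(3)] by blast
  have W: "(\<lambda>s. \<alpha> s * deriv \<beta> s - deriv \<alpha> s * \<beta> s) holomorphic_on T"
    by (intro holomorphic_intros holo holomorphic_deriv T(1))
  \<comment> \<open>The second slide reaches a parameter with nonzero Wronskian while keeping a
    point y in the hyperplane at which the induction hypothesis can be applied.\<close>
  obtain t\<^sub>2 y where t\<^sub>2: "t\<^sub>2 \<in> T" "\<alpha> t\<^sub>2 * deriv \<beta> t\<^sub>2 - deriv \<alpha> t\<^sub>2 * \<beta> t\<^sub>2 \<noteq> 0" "y \<in> S" "y \<in> \<B>"
      "bilin y (f\<^sub>0 + t\<^sub>2 *s v\<^sub>0) = 0" "A y \<zeta>\<^sub>1 \<noteq> 0"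
    using slice[OF S t(3,3,4,4) Suc.prems(3) f0(3,3) z1f0 T(1-3) W t\<^sub>1 \<kappa>, of v\<^sub>0] t(6) by blast
  define g where "g = f\<^sub>0 + t\<^sub>2 *s v\<^sub>0"
  define S' where "S' = S \<inter> {x. bilin x g = 0}"
  define u' where "u' = (\<lambda>j. deriv (\<lambda>s. \<theta> j (f\<^sub>0 + s *s v\<^sub>0)) t\<^sub>2)"
  have g: "g \<in> \<B>" using t\<^sub>2(1) by (simp add: g_def T_def line_dom_def)
  have IH: "indep_on S' (Suc (2 * d))"
    using Suc.IH[of S' y] Suc.prems(2) dim_kernel_ge[OF S, of g] subspace_kernel[OF S, of g] t\<^sub>2
    by (auto simp: S'_def g_def)
  have deriv: "((\<lambda>s. A x (f\<^sub>0 + s *s v\<^sub>0)) has_field_derivative ev u' x) (at t\<^sub>2)" for x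
    unfolding u'_def using t\<^sub>2(1) by (intro ev_deriv) (simp add: T_def)
  have "indep_on S (Suc (Suc (Suc (2 * d))))"
  proof (rule indep_on_Suc_Suc[OF IH, of S "\<lambda>j. \<theta> j g" u' x z\<^sub>1])
    show "ev (\<lambda>j. \<theta> j g) x = 0" if "x \<in> S' \<inter> \<B>" for x
      using that g A_0[of x g] by (simp add: A_def S'_def)
    show "ev u' x = 0" if x: "x \<in> S' \<inter> \<B>" for x
    proof -
      have xg: "bilin x g = 0" "x \<in> \<B>" using x by (auto simp: S'_def)
      have "(\<lambda>s. H x (f\<^sub>0 + s *s v\<^sub>0)) holomorphic_on T"
        unfolding T_def using xg(2) by (intro holomorphic_intros) auto
      then obtain D where D: "((\<lambda>s. H x (f\<^sub>0 + s *s v\<^sub>0)) has_field_derivative D) (at t\<^sub>2)"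
        using t\<^sub>2(1) T(1) holomorphic_derivI by blast
      have H0: "H x (f\<^sub>0 + t\<^sub>2 *s v\<^sub>0) = 0" using inc[OF xg(2) g xg(1)] by (simp add: g_def)
      \<comment> \<open>The factor \<open>s\<close> minus the contact parameter comes from the
        pairing; with the zero of H there it makes a double zero, so the derivative
        vanishes.\<close>
      have "((\<lambda>s. bilin x v\<^sub>0 * ((s - t\<^sub>2) * H x (f\<^sub>0 + s *s v\<^sub>0))) has_field_derivative 0) (at t\<^sub>2)"
        by (rule derivative_eq_intros D refl | simp add: H0)+
      moreover have "A x (f\<^sub>0 + s *s v\<^sub>0) = bilin x v\<^sub>0 * ((s - t\<^sub>2) * H x (f\<^sub>0 + s *s v\<^sub>0))" if "s \<in> T" for s
      proof -
        have "f\<^sub>0 + s *s v\<^sub>0 \<in> \<B>" using that by (simp add: T_def line_dom_def)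
        moreover have "f\<^sub>0 + s *s v\<^sub>0 = g + (s - t\<^sub>2) *s v\<^sub>0"
          by (simp add: g_def vec.scale_left_diff_distrib)
        then have "bilin x (f\<^sub>0 + s *s v\<^sub>0) = (s - t\<^sub>2) * bilin x v\<^sub>0"
          using xg(1) by (simp only: bilin_add bilin_scale) simp
        ultimately show ?thesis using A_eq[OF xg(2)] by simp
      qed
      ultimately have "((\<lambda>s. A x (f\<^sub>0 + s *s v\<^sub>0)) has_field_derivative 0) (at t\<^sub>2)"
        using T(1) t\<^sub>2(1) by (auto elim!: has_field_derivative_transform_within_open)
      then show ?thesis using deriv DERIV_unique by blast
    qed
    have "deriv \<alpha> t\<^sub>2 = ev u' x" "deriv \<beta> t\<^sub>2 = ev u' z\<^sub>1"
      unfolding \<alpha>_def \<beta>_def using deriv DERIV_imp_deriv by blast+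
    then show "ev (\<lambda>j. \<theta> j g) x * ev u' z\<^sub>1 - ev (\<lambda>j. \<theta> j g) z\<^sub>1 * ev u' x \<noteq> 0"
      using t\<^sub>2(2) by (simp add: \<alpha>_def \<beta>_def A_def g_def mult.commute)
  qed (use t Suc.prems S'_def in auto)
  then show ?case by simp
qed

definition minor :: "complex ^ 'n \<Rightarrow> complex ^ 'n \<Rightarrow> complex ^ 'n \<Rightarrow> complex ^ 'n \<Rightarrow> complex"
  where "minor z z' f f' = H z f * H z' f' - H z' f * H z f'"

text \<open>The pairings are included because the determinant of the two new functions at z and z'
  is a minor times these two factors; one nonvanishing condition can then be carried along a
  line.\<close>

definition wminor :: "complex ^ 'n \<Rightarrow> complex ^ 'n \<Rightarrow> complex ^ 'n \<Rightarrow> complex ^ 'n \<Rightarrow> complex"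
  where "wminor \<zeta>\<^sub>0 z z' f = minor z z' \<zeta>\<^sub>0 f * bilin z f * bilin z' f"

lemma minor_holo_left:
  assumes "f \<in> \<B>" "f' \<in> \<B>"
  shows "(\<lambda>t. minor (a + t *s b) (a' + t *s b') f f') holomorphic_on line_dom R a b \<inter> line_dom R a' b'"
  unfolding minor_def using assms by (intro holomorphic_intros) auto

lemma wminor_holo_left:
  assumes "\<zeta>\<^sub>0 \<in> \<B>" "f \<in> \<B>"
  shows "(\<lambda>t. wminor \<zeta>\<^sub>0 (a + t *s b) (a' + t *s b') f) holomorphic_on line_dom R a b \<inter> line_dom R a' b'"
  unfolding wminor_def using assms by (intro holomorphic_intros minor_holo_left)

lemma wminor_holo_right:
  assumes "\<zeta>\<^sub>0 \<in> \<B>" "z \<in> \<B>" "z' \<in> \<B>"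
  shows "(\<lambda>t. wminor \<zeta>\<^sub>0 z z' (c + t *s d)) holomorphic_on line_dom R c d"
  unfolding wminor_def minor_def using assms by (intro holomorphic_intros) auto

text \<open>On S the pairing with \<zeta> is zero, so A(., \<zeta> + s f) as well as A(., f)
  vanishes on the section by f. Their determinant at z and z' is s times both pairings with f times
  a minor.\<close>

lemma indep_on_step:
  assumes "\<zeta>\<^sub>0 \<in> \<B>" "\<And>x. x \<in> S \<Longrightarrow> bilin x \<zeta>\<^sub>0 = 0"
    and "z \<in> S" "z' \<in> S" "z \<in> \<B>" "z' \<in> \<B>" "f \<in> \<B>" "wminor \<zeta>\<^sub>0 z z' f \<noteq> 0"
    and "indep_on (S \<inter> {x. bilin x f = 0}) k"
  shows "indep_on S (Suc (Suc k))"
proof -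
  define G where "G = (\<lambda>s. minor z z' f (\<zeta>\<^sub>0 + s *s f))"
  have hol: "G holomorphic_on line_dom R \<zeta>\<^sub>0 f"
    unfolding G_def minor_def using assms by (intro holomorphic_intros) auto
  \<comment> \<open>At s = 0 the function G is minus the minor inside \<open>wminor\<close>; hence
    it is nonzero for some s other than 0, as the factor s in the determinant requires.\<close>
  have nz: "G 0 \<noteq> 0" using assms(8) by (auto simp: G_def wminor_def minor_def mult.commute)
  have mem: "0 \<in> line_dom R \<zeta>\<^sub>0 f" using assms(1) by (simp add: line_dom_def)
  obtain s where s: "s \<in> line_dom R \<zeta>\<^sub>0 f" "s \<noteq> 0" "G s \<noteq> 0"
    using line_nonzero_near[OF hol, of 0 0 1] mem nz by auto
  then have f': "\<zeta>\<^sub>0 + s *s f \<in> \<B>" by (simp add: line_dom_def)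
  have Af': "A x (\<zeta>\<^sub>0 + s *s f) = s * bilin x f * H x (\<zeta>\<^sub>0 + s *s f)" if "x \<in> S" "x \<in> \<B>" for x
    using A_eq[OF that(2) f'] assms(2)[OF that(1)] by simp
  show ?thesis
  proof (rule indep_on_Suc_Suc[OF assms(9), of S "\<lambda>j. \<theta> j f" "\<lambda>j. \<theta> j (\<zeta>\<^sub>0 + s *s f)" z z'])
    show "ev (\<lambda>j. \<theta> j f) x = 0" if "x \<in> S \<inter> {x. bilin x f = 0} \<inter> \<B>" for x
      using A_0[of x f] that assms(7) by (simp add: A_def)
    show "ev (\<lambda>j. \<theta> j (\<zeta>\<^sub>0 + s *s f)) x = 0" if "x \<in> S \<inter> {x. bilin x f = 0} \<inter> \<B>" for x
      using Af'[of x] that by (simp add: A_def)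
    have "A z f * A z' (\<zeta>\<^sub>0 + s *s f) - A z' f * A z (\<zeta>\<^sub>0 + s *s f) = s * bilin z f * bilin z' f * G s"
      using assms Af'[of z] Af'[of z'] A_eq[of z f] A_eq[of z' f]
      by (simp add: G_def minor_def algebra_simps)
    moreover have "\<dots> \<noteq> 0" using s assms(8) by (auto simp: wminor_def)
    ultimately show "ev (\<lambda>j. \<theta> j f) z * ev (\<lambda>j. \<theta> j (\<zeta>\<^sub>0 + s *s f)) z'
        - ev (\<lambda>j. \<theta> j f) z' * ev (\<lambda>j. \<theta> j (\<zeta>\<^sub>0 + s *s f)) z \<noteq> 0"
      by (simp add: A_def)
  qed (use assms in auto)
qed

text \<open>Each hyperplane section gives up one dimension for two functions. The induction starts
  in dimension two, where the section still carries one nonzero function, so three in all.\<close>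

lemma indep_on_if_wminor:
  assumes \<zeta>\<^sub>0: "\<zeta>\<^sub>0 \<in> \<B>" and f: "f \<in> \<B>"
    and "vec.subspace S" "\<And>x. x \<in> S \<Longrightarrow> bilin x \<zeta>\<^sub>0 = 0" "Suc (Suc d) \<le> vec.dim S"
    and "z \<in> S" "z' \<in> S" "z \<in> \<B>" "z' \<in> \<B>" "wminor \<zeta>\<^sub>0 z z' f \<noteq> 0"
  shows "indep_on S (Suc (Suc (Suc (2 * d))))"
  using assms(3-)
proof (induction d arbitrary: S z z')
  case 0
  note S = \<open>vec.subspace S\<close>
  have "H z f \<noteq> 0 \<or> H z' f \<noteq> 0" "bilin z f \<noteq> 0" "bilin z' f \<noteq> 0"
    using 0 by (auto simp: wminor_def minor_def)
  then obtain y where y: "y \<in> S" "y \<in> \<B>" "A y f \<noteq> 0"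
    using 0 f A_eq by (metis mult_eq_0_iff)
  obtain p where p: "p \<in> S" "p \<notin> vec.span {y}"
    using exists_outside_span[of "{y}" S] 0 by auto
  obtain f\<^sub>0 where f\<^sub>0: "f\<^sub>0 \<in> \<B>" "\<And>x. x \<in> vec.span {y} \<Longrightarrow> bilin x f\<^sub>0 = 0" "bilin p f\<^sub>0 \<noteq> 0"
    using separate_from_subspace[OF vec.subspace_span p(2) R_pos] by metis
  have yf: "bilin y f\<^sub>0 = 0" using f\<^sub>0(2) by (simp add: vec.span_base)
  define v where "v = f - f\<^sub>0"
  have ends: "0 \<in> line_dom R f\<^sub>0 v" "1 \<in> line_dom R f\<^sub>0 v"
    using f\<^sub>0(1) f by (auto simp: line_dom_def v_def)
  have \<kappa>: "(\<lambda>t. (\<lambda>y _. A y f) (a + t *s b) (a' + t *s b')) holomorphic_on line_dom R a b \<inter> line_dom R a' b'"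
    for a b a' b' by (intro holomorphic_intros) auto
  have w: "(\<lambda>t. wminor \<zeta>\<^sub>0 z z' (f\<^sub>0 + t *s v)) holomorphic_on line_dom R f\<^sub>0 v"
    by (rule wminor_holo_right[OF \<zeta>\<^sub>0 0(6,7)])
  have w1: "wminor \<zeta>\<^sub>0 z z' (f\<^sub>0 + 1 *s v) \<noteq> 0" using 0 by (simp add: v_def)
  \<comment> \<open>Slide to a hyperplane for which \<open>wminor\<close> is nonzero and which
    contains a point x with \<open>A x f\<close> nonzero; x supplies the one function on the
    section.\<close>
  obtain t x where t: "t \<in> line_dom R f\<^sub>0 v" "wminor \<zeta>\<^sub>0 z z' (f\<^sub>0 + t *s v) \<noteq> 0" "x \<in> S" "x \<in> \<B>"
      "bilin x (f\<^sub>0 + t *s v) = 0" "A x f \<noteq> 0"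
    using slice[OF S y(1,1,2,2) p(1) yf yf f\<^sub>0(3) open_line_dom convex_line_dom ends(1) w ends(2) w1 \<kappa> y(3), of v]
    by blast
  have "indep_on (S \<inter> {x. bilin x (f\<^sub>0 + t *s v) = 0}) (Suc 0)"
    using t by (intro indep_on_1[of x _ f]) auto
  then show ?case
    using indep_on_step[OF \<zeta>\<^sub>0 0(2,4-7) _ t(2)] t(1) by (auto simp: line_dom_def)
next
  case (Suc d)
  note S = \<open>vec.subspace S\<close>
  have "card {z, z'} < vec.dim S"
    using Suc.prems(3) card_insert_le_m1[of 2 "{z'}" z] by simp
  then obtain p where p: "p \<in> S" "p \<notin> vec.span {z, z'}"
    using exists_outside_span[of "{z, z'}" S] by auto
  obtain f\<^sub>0 where f\<^sub>0: "f\<^sub>0 \<in> \<B>" "\<And>x. x \<in> vec.span {z, z'} \<Longrightarrow> bilin x f\<^sub>0 = 0" "bilin p f\<^sub>0 \<noteq> 0"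
    using separate_from_subspace[OF vec.subspace_span p(2) R_pos] by metis
  have zf: "bilin z f\<^sub>0 = 0" "bilin z' f\<^sub>0 = 0" using f\<^sub>0(2) by (simp_all add: vec.span_base)
  define v where "v = f - f\<^sub>0"
  have ends: "0 \<in> line_dom R f\<^sub>0 v" "1 \<in> line_dom R f\<^sub>0 v"
    using f\<^sub>0(1) f by (auto simp: line_dom_def v_def)
  have w: "(\<lambda>t. wminor \<zeta>\<^sub>0 z z' (f\<^sub>0 + t *s v)) holomorphic_on line_dom R f\<^sub>0 v"
    by (rule wminor_holo_right[OF \<zeta>\<^sub>0 Suc.prems(6,7)])
  have w1: "wminor \<zeta>\<^sub>0 z z' (f\<^sub>0 + 1 *s v) \<noteq> 0" using Suc.prems by (simp add: v_def)
  obtain t x x' where t: "t \<in> line_dom R f\<^sub>0 v" "wminor \<zeta>\<^sub>0 z z' (f\<^sub>0 + t *s v) \<noteq> 0" "x \<in> S" "x' \<in> S"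
      "x \<in> \<B>" "x' \<in> \<B>" "bilin x (f\<^sub>0 + t *s v) = 0" "bilin x' (f\<^sub>0 + t *s v) = 0" "wminor \<zeta>\<^sub>0 x x' f \<noteq> 0"
    \<comment> \<open>Here both points are carried along, so that a pair with nonzero
      \<open>wminor\<close> survives in the section for the induction hypothesis.\<close>
    using slice[OF S Suc.prems(4-7) p(1) zf f\<^sub>0(3) open_line_dom convex_line_dom ends(1) w ends(2) w1
        wminor_holo_left[OF \<zeta>\<^sub>0 f] Suc.prems(8), of v]
    by blast
  define g where "g = f\<^sub>0 + t *s v"
  have "indep_on (S \<inter> {x. bilin x g = 0}) (Suc (Suc (Suc (2 * d))))"
    using Suc.IH[of "S \<inter> {x. bilin x g = 0}" x x'] subspace_kernel[OF S, of g] dim_kernel_ge[OF S, of g]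
      Suc.prems(2,3) t by (auto simp: g_def)
  moreover have "g \<in> \<B>" using t(1) by (simp add: g_def line_dom_def)
  ultimately show ?case
    using indep_on_step[OF \<zeta>\<^sub>0 Suc.prems(2,4-7), of g] t(2) by (simp add: g_def)
qed

end


section \<open>Vanishing of all minors\<close>

context holomorphic_kernel
begin

text \<open>
  For \<open>z, z'\<close> orthogonal to a common \<open>\<zeta>\<close> the hypothesis makes \<open>H z\<close> and \<open>H z'\<close> proportional to
  \<open>H z\<^sub>0\<close> for any \<open>z\<^sub>0 \<bottom> \<zeta>\<close> with \<open>H z\<^sub>0 \<zeta> \<noteq> 0\<close>; in dimension at least 3 such a \<open>\<zeta>\<close> always exists.
\<close>

lemma minor_vanishes:
  assumes dim: "3 \<le> CARD('n)"
    and "z\<^sub>0 \<in> \<B>" "\<eta> \<in> \<B>" "bilin z\<^sub>0 \<eta> = 0" "H z\<^sub>0 \<eta> \<noteq> 0"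
    and mu: "\<And>\<zeta> z z' f. \<lbrakk>\<zeta> \<in> \<B>; \<zeta> \<noteq> 0; z \<in> \<B>; z' \<in> \<B>; f \<in> \<B>; bilin z \<zeta> = 0; bilin z' \<zeta> = 0\<rbrakk>
      \<Longrightarrow> minor z z' \<zeta> f = 0"
    and "z \<in> \<B>" "z' \<in> \<B>" "f \<in> \<B>" "f' \<in> \<B>"
  shows "minor z z' f f' = 0"
proof (rule ccontr)
  assume nz: "minor z z' f f' \<noteq> 0"
  have dimU: "vec.dim (UNIV :: (complex ^ 'n) set) = CARD('n)" by (rule vec_dim_card)
  obtain \<zeta>\<^sub>0 where \<zeta>\<^sub>0: "\<zeta>\<^sub>0 \<in> \<B>" "\<zeta>\<^sub>0 \<noteq> 0" "bilin z\<^sub>0 \<zeta>\<^sub>0 = 0" "H z\<^sub>0 \<zeta>\<^sub>0 \<noteq> 0"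
  proof (cases "\<eta> = 0")
    \<comment> \<open>The parameter 0 defines no hyperplane; it is moved slightly in a direction
      orthogonal to the given point.\<close>
    case True
    obtain p where p: "p \<notin> vec.span {z\<^sub>0}"
      using exists_outside_span[of "{z\<^sub>0}" UNIV] dim dimU by auto
    obtain g where g: "\<And>x. x \<in> vec.span {z\<^sub>0} \<Longrightarrow> bilin x g = 0" "bilin p g \<noteq> 0"
      using separate_from_subspace[OF vec.subspace_span p R_pos] by metis
    have hol: "(\<lambda>s. H z\<^sub>0 (0 + s *s g)) holomorphic_on line_dom R 0 g"
      using assms(2) by (intro holomorphic_intros) auto
    have mem: "0 \<in> line_dom R 0 g" using R_pos by (simp add: line_dom_def)
    have nz: "H z\<^sub>0 (0 + 0 *s g) \<noteq> 0" using True assms(5) by simp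
    obtain s where s: "s \<in> line_dom R 0 g" "s \<noteq> 0" "H z\<^sub>0 (0 + s *s g) \<noteq> 0"
      using line_nonzero_near[OF hol, of 0 0 1] mem nz by auto
    have "bilin z\<^sub>0 g = 0" using g(1) by (simp add: vec.span_base)
    moreover have "g \<noteq> 0" using g(2) by auto
    ultimately show ?thesis
      using that[of "s *s g"] s by (auto simp: line_dom_def)
  qed (use assms that in blast)
  have "card {z, z'} < vec.dim (UNIV :: (complex ^ 'n) set)"
    using dim dimU card_insert_le_m1[of 2 "{z'}" z] by simp
  then obtain p where p: "p \<notin> vec.span {z, z'}"
    using exists_outside_span[of "{z, z'}" UNIV] by auto
  obtain \<zeta>\<^sub>1 where \<zeta>\<^sub>1: "\<zeta>\<^sub>1 \<in> \<B>" "\<And>x. x \<in> vec.span {z, z'} \<Longrightarrow> bilin x \<zeta>\<^sub>1 = 0" "bilin p \<zeta>\<^sub>1 \<noteq> 0"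
    using separate_from_subspace[OF vec.subspace_span p R_pos] by metis
  have z\<zeta>: "bilin z \<zeta>\<^sub>1 = 0" "bilin z' \<zeta>\<^sub>1 = 0" using \<zeta>\<^sub>1(2) by (simp_all add: vec.span_base)
  obtain p\<^sub>0 where p\<^sub>0: "bilin p\<^sub>0 \<zeta>\<^sub>0 \<noteq> 0" using bilin_nondegenerate[OF \<zeta>\<^sub>0(2)] .
  define v where "v = \<zeta>\<^sub>0 - \<zeta>\<^sub>1"
  \<comment> \<open>With this c the point moving with velocity -c stays orthogonal to the parameter
    moving with velocity v.\<close>
  define c where "c = (1 / bilin p\<^sub>0 \<zeta>\<^sub>0) *s (bilin z\<^sub>0 v *s p\<^sub>0 - bilin p\<^sub>0 v *s z\<^sub>0)"
  have cv: "bilin c v = 0" and c\<zeta>: "bilin c \<zeta>\<^sub>0 = bilin z\<^sub>0 v"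
    using p\<^sub>0 \<zeta>\<^sub>0(3) by (simp_all add: c_def)
  define M where "M = 1 + norm (z\<^sub>0 + c)"
  have M: "M > 0" by (simp add: M_def add_pos_nonneg)
  have hol: "(\<lambda>t. H (0 + t *s z\<^sub>0) \<zeta>\<^sub>0) holomorphic_on line_dom R 0 z\<^sub>0"
    using \<zeta>\<^sub>0(1) by (intro holomorphic_intros) auto
  have mem: "1 \<in> line_dom R 0 z\<^sub>0" "0 \<in> line_dom R 0 z\<^sub>0"
    using assms(2) R_pos by (auto simp: line_dom_def)
  have nz1: "H (0 + 1 *s z\<^sub>0) \<zeta>\<^sub>0 \<noteq> 0" and RM: "R / M > 0" using \<zeta>\<^sub>0(4) R_pos M by simp_all
  obtain l where l: "l \<in> line_dom R 0 z\<^sub>0" "dist l 0 < R / M" "H (0 + l *s z\<^sub>0) \<zeta>\<^sub>0 \<noteq> 0"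
    using line_nonzero_near[OF hol mem(1) nz1 mem(2) RM] by blast
  have "cmod l * M < R" using l(2) M by (simp add: field_simps)
  moreover have "cmod l * norm (z\<^sub>0 + c) \<le> cmod l * M" by (intro mult_left_mono) (auto simp: M_def)
  ultimately have lM: "norm (l *s (z\<^sub>0 + c)) < R" unfolding norm_vector_smult_complex by linarith
  define a where "a = l *s (z\<^sub>0 + c)"
  define b where "b = - l *s c"
  have ab: "a + 1 *s b = l *s z\<^sub>0"
    by (simp add: a_def b_def vec.scale_right_distrib)
  define T where "T = line_dom R \<zeta>\<^sub>1 v \<inter> line_dom R a b"
  have T: "open T" "convex T" "0 \<in> T" "1 \<in> T"
  proof -
    show "open T" "convex T" by (simp_all add: T_def open_line_dom convex_line_dom open_Int convex_Int)
    show "0 \<in> T" using \<zeta>\<^sub>1(1) lM by (simp add: T_def line_dom_def a_def del: vec.scale_right_distrib)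
    have "a + 1 *s b \<in> \<B>" using l(1) unfolding ab line_dom_def by simp
    moreover have "\<zeta>\<^sub>1 + 1 *s v \<in> \<B>" using \<zeta>\<^sub>0(1) by (simp add: v_def)
    ultimately show "1 \<in> T" by (simp only: T_def line_dom_def mem_Collect_eq Int_iff)
  qed
  \<comment> \<open>The first factor keeps H nonzero at the moving point and the moving parameter;
    the second keeps that parameter different from 0.\<close>
  define w where "w = (\<lambda>t. H (a + t *s b) (\<zeta>\<^sub>1 + t *s v) * bilin p\<^sub>0 (\<zeta>\<^sub>1 + t *s v))"
  have w: "w holomorphic_on T"
    unfolding w_def T_def by (intro holomorphic_intros) auto
  have w1: "w 1 \<noteq> 0"
    unfolding w_def ab using l(3) p\<^sub>0 by (simp add: v_def)
  obtain t x x' where t: "t \<in> T" "w t \<noteq> 0" "x \<in> \<B>" "x' \<in> \<B>" "bilin x (\<zeta>\<^sub>1 + t *s v) = 0"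
      "bilin x' (\<zeta>\<^sub>1 + t *s v) = 0" "minor x x' f f' \<noteq> 0"
    using slice[OF vec.subspace_UNIV UNIV_I UNIV_I assms(7,8) UNIV_I z\<zeta> \<zeta>\<^sub>1(3) T(1-3) w T(4) w1
        minor_holo_left[OF assms(9,10)] nz, of v] by metis
  define \<zeta> where "\<zeta> = \<zeta>\<^sub>1 + t *s v"
  define y where "y = a + t *s b"
  have "\<zeta> = \<zeta>\<^sub>0 + (t - 1) *s v" by (simp add: \<zeta>_def v_def vec.scale_left_diff_distrib)
  moreover have "y = l *s (z\<^sub>0 - (t - 1) *s c)"
    by (simp add: y_def a_def b_def vec.scale_right_distrib vec.scale_left_diff_distrib
        vec.scale_right_diff_distrib vec.scale_left_distrib algebra_simps)
  ultimately have y\<zeta>: "bilin y \<zeta> = 0"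
    using cv c\<zeta> \<zeta>\<^sub>0(3) by simp
  have y: "y \<in> \<B>" "\<zeta> \<in> \<B>" using t(1) by (simp_all add: T_def line_dom_def y_def \<zeta>_def)
  have nz': "H y \<zeta> \<noteq> 0" "\<zeta> \<noteq> 0"
    using t(2) unfolding w_def y_def[symmetric] \<zeta>_def[symmetric] by auto
  \<comment> \<open>Every H(x, .) with x orthogonal to \<zeta> is a multiple of H(y, .), so any
    minor of two such x is zero.\<close>
  have eq: "H x g = H x \<zeta> / H y \<zeta> * H y g" if "x \<in> \<B>" "bilin x \<zeta> = 0" "g \<in> \<B>" for x g
    using mu[OF y(2) nz'(2) y(1) that(1,3) y\<zeta> that(2)] nz'(1) by (simp add: minor_def field_simps)
  have "minor x x' f f' = 0"
    unfolding minor_def using t(3-6) assms(9,10)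
    by (simp add: eq[of x] eq[of x'] \<zeta>_def)
  then show False using t(7) by simp
qed

text \<open>Shift both points by t q and the parameter by t h with \<open>bilin q h\<close> nonzero:
  for some t the minor is still nonzero and neither pairing vanishes.\<close>

lemma exists_wminor:
  assumes S: "vec.subspace S" "q \<in> S" "q \<noteq> 0" and \<zeta>: "\<zeta> \<in> \<B>"
    and "z \<in> S" "z' \<in> S" "z \<in> \<B>" "z' \<in> \<B>" "f \<in> \<B>" "minor z z' \<zeta> f \<noteq> 0"
  obtains x x' g where "x \<in> S" "x' \<in> S" "x \<in> \<B>" "x' \<in> \<B>" "g \<in> \<B>" "wminor \<zeta> x x' g \<noteq> 0"
proof -
  have "q \<notin> vec.span {}" using S by simp
  then obtain h where h: "bilin q h \<noteq> 0"
    using separate_from_subspace[OF vec.subspace_span _ R_pos] by metis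
  define T where "T = line_dom R z q \<inter> line_dom R z' q \<inter> line_dom R f h"
  have T: "open T" "connected T" "0 \<in> T"
  proof -
    show "open T" unfolding T_def by (intro open_Int open_line_dom)
    show "connected T" unfolding T_def by (intro convex_connected convex_Int convex_line_dom)
    show "0 \<in> T" using assms by (simp add: T_def line_dom_def)
  qed
  define F where "F = (\<lambda>t. minor (z + t *s q) (z' + t *s q) \<zeta> (f + t *s h))"
  have F: "F holomorphic_on T" "F 0 \<noteq> 0"
    unfolding F_def minor_def T_def using assms
    by (intro holomorphic_intros; auto) (use assms in \<open>simp add: minor_def\<close>)
  obtain t\<^sub>1 where t\<^sub>1: "t\<^sub>1 \<in> T" "F t\<^sub>1 \<noteq> 0" "bilin (z + t\<^sub>1 *s q) (f + t\<^sub>1 *s h) \<noteq> 0"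
    using perturb_off_incidence[OF F(1) T F(2) h] by metis
  obtain t\<^sub>2 where t\<^sub>2: "t\<^sub>2 \<in> T" "F t\<^sub>2 \<noteq> 0" "bilin (z' + t\<^sub>2 *s q) (f + t\<^sub>2 *s h) \<noteq> 0"
    using perturb_off_incidence[OF F(1) T F(2) h] by metis
  define G where "G = (\<lambda>t. F t * bilin (z + t *s q) (f + t *s h))"
  have G: "G holomorphic_on T" "G t\<^sub>1 \<noteq> 0"
    unfolding G_def using t\<^sub>1 by (auto intro!: holomorphic_intros F)
  obtain t where t: "t \<in> T" "G t \<noteq> 0" "bilin (z' + t *s q) (f + t *s h) \<noteq> 0"
    using holomorphic_joint_nonzero[OF G(1) bilin_holo T(1,2) t\<^sub>1(1) G(2) t\<^sub>2(1,3)] by metis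
  show ?thesis
  proof (rule that)
    show "z + t *s q \<in> S" "z' + t *s q \<in> S"
      using assms by (auto intro: vec.subspace_add vec.subspace_scale)
    show "z + t *s q \<in> \<B>" "z' + t *s q \<in> \<B>" "f + t *s h \<in> \<B>"
      using t(1) by (simp_all add: T_def line_dom_def)
    show "wminor \<zeta> (z + t *s q) (z' + t *s q) (f + t *s h) \<noteq> 0"
      using t(2,3) by (simp add: G_def F_def wminor_def del: bilin_add)
  qed
qed

text \<open>Each way in which the minors could fail to vanish produces more than N independent
  functions, against \<open>indep_on_le\<close>.\<close>

theorem rank_one:
  assumes dim: "3 \<le> CARD('n)" "N + 3 \<le> 2 * CARD('n)"
    and "z \<in> \<B>" "z' \<in> \<B>" "f \<in> \<B>" "f' \<in> \<B>"
  shows "H z f * H z' f' = H z' f * H z f'"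
proof (cases "\<exists>z\<^sub>0\<in>\<B>. \<exists>\<eta>\<in>\<B>. bilin z\<^sub>0 \<eta> = 0 \<and> H z\<^sub>0 \<eta> \<noteq> 0")
  case False
  show ?thesis
  proof (cases "\<exists>z\<^sub>1\<in>\<B>. \<exists>\<zeta>\<^sub>1\<in>\<B>. A z\<^sub>1 \<zeta>\<^sub>1 \<noteq> 0")
    case True
    then obtain z\<^sub>1 \<zeta>\<^sub>1 where *: "z\<^sub>1 \<in> \<B>" "\<zeta>\<^sub>1 \<in> \<B>" "A z\<^sub>1 \<zeta>\<^sub>1 \<noteq> 0" by blast
    \<comment> \<open>With m the dimension these are 2m - 1 functions, more than N.\<close>
    have "indep_on UNIV (Suc (2 * (CARD('n) - 1)))"
      by (rule indep_on_if_vanishing[where S = UNIV, OF _ *(2) vec.subspace_UNIV _ UNIV_I *(1,3)])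
        (use False in \<open>auto simp: card_cart_basis\<close>)
    then show ?thesis using indep_on_le dim by fastforce
  next
    case A0: False
    \<comment> \<open>If A is zero, then H vanishes wherever the pairing does not, and a
      perturbation off the incidence variety carries this to every point.\<close>
    have "H z f = 0" if zf: "z \<in> \<B>" "f \<in> \<B>" for z f
    proof (rule ccontr)
      assume nz: "H z f \<noteq> 0"
      define b where "b = (axis undefined 1 :: complex ^ 'n)"
      obtain d where d: "bilin b d \<noteq> 0"
      proof -
        have "b \<noteq> 0" by (simp add: b_def axis_eq_0_iff)
        then have "b \<notin> vec.span {}" by simp
        then show ?thesis using separate_from_subspace[OF vec.subspace_span _ R_pos] that by metis
      qed
      define T where "T = line_dom R z b \<inter> line_dom R f d"
      have T: "open T" "connected T" "0 \<in> T"
      proof -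
        show "open T" unfolding T_def by (intro open_Int open_line_dom)
        show "connected T" unfolding T_def by (intro convex_connected convex_Int convex_line_dom)
        show "0 \<in> T" using zf by (simp add: T_def line_dom_def)
      qed
      have "(\<lambda>t. H (z + t *s b) (f + t *s d)) holomorphic_on T"
        unfolding T_def by (intro holomorphic_intros) auto
      then obtain t where "t \<in> T" "H (z + t *s b) (f + t *s d) \<noteq> 0" "bilin (z + t *s b) (f + t *s d) \<noteq> 0"
        using perturb_off_incidence[OF _ T _ d, of "\<lambda>t. H (z + t *s b) (f + t *s d)" z f] nz by auto
      then show False
        using A0 A_eq[of "z + t *s b" "f + t *s d"] by (auto simp: T_def line_dom_def simp del: bilin_add)
    qed
    then show ?thesis using assms by simp
  qed
next
  case True
  then obtain z\<^sub>0 \<eta> where z\<^sub>0: "z\<^sub>0 \<in> \<B>" "\<eta> \<in> \<B>" "bilin z\<^sub>0 \<eta> = 0" "H z\<^sub>0 \<eta> \<noteq> 0" by blast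
  have "minor x x' \<zeta> g = 0"
    if *: "\<zeta> \<in> \<B>" "\<zeta> \<noteq> 0" "x \<in> \<B>" "x' \<in> \<B>" "g \<in> \<B>" "bilin x \<zeta> = 0" "bilin x' \<zeta> = 0" for \<zeta> x x' g
  proof (rule ccontr)
    assume nz: "minor x x' \<zeta> g \<noteq> 0"
    define S where "S = UNIV \<inter> {x. bilin x \<zeta> = 0}"
    have S: "vec.subspace S" unfolding S_def by (rule subspace_kernel) simp
    have dimS: "CARD('n) \<le> Suc (vec.dim S)"
      using dim_kernel_ge[OF vec.subspace_UNIV, of \<zeta>] by (simp add: S_def card_cart_basis)
    obtain q where q: "q \<in> S" "q \<notin> vec.span {}"
      using exists_outside_span[of "{}" S] dimS dim by auto
    have S\<zeta>: "bilin x \<zeta> = 0" if "x \<in> S" for x using that by (simp add: S_def)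
    have xS: "x \<in> S" "x' \<in> S" using * by (simp_all add: S_def)
    obtain y y' h where y: "y \<in> S" "y' \<in> S" "y \<in> \<B>" "y' \<in> \<B>" "h \<in> \<B>" "wminor \<zeta> y y' h \<noteq> 0"
      using exists_wminor[OF S q(1) _ *(1) xS *(3-5) nz] q(2) by auto
    \<comment> \<open>The hyperplane S has dimension at least m - 1 = d + 2 and so carries 2d + 3 =
      2m - 3 independent functions. Adding A(., \<zeta>), which vanishes on S, gives 2m - 2.\<close>
    define d where "d = CARD('n) - 3"
    have "Suc (Suc d) \<le> vec.dim S" using dimS dim by (simp add: d_def)
    note ind = indep_on_if_wminor[OF *(1) y(5) S S\<zeta> this y(1-4,6)]
    have "\<exists>u\<in>\<B>. A u \<zeta> \<noteq> 0"
    proof -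
      have "H x \<zeta> \<noteq> 0 \<or> H x' \<zeta> \<noteq> 0" using nz by (auto simp: minor_def)
      then obtain y where y: "y \<in> \<B>" "H y \<zeta> \<noteq> 0" "bilin y \<zeta> = 0" using * by blast
      obtain p where p: "bilin p \<zeta> \<noteq> 0" using bilin_nondegenerate[OF *(2)] .
      have hol: "(\<lambda>t. H (y + t *s p) \<zeta>) holomorphic_on line_dom R y p"
        using *(1) by (intro holomorphic_intros) auto
      have mem: "0 \<in> line_dom R y p" and nz: "H (y + 0 *s p) \<zeta> \<noteq> 0"
        using y by (simp_all add: line_dom_def)
      obtain t where "t \<in> line_dom R y p" "t \<noteq> 0" "H (y + t *s p) \<zeta> \<noteq> 0"
        using line_nonzero_near[OF hol, of 0 0 1] mem nz by auto
      then show ?thesis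
        using A_eq[of "y + t *s p" \<zeta>] *(1) p y(3)
        by (intro bexI[of _ "y + t *s p"]) (auto simp: line_dom_def)
    qed
    then obtain u where u: "u \<in> \<B>" "A u \<zeta> \<noteq> 0" by blast
    have "indep_on UNIV (Suc (Suc (Suc (Suc (2 * d)))))"
    proof (rule indep_on_Suc[OF ind])
      show "ev (\<lambda>j. \<theta> j \<zeta>) x = 0" if "x \<in> S \<inter> \<B>" for x
        using A_0[of x \<zeta>] S\<zeta> that *(1) by (simp add: A_def)
    qed (use u in \<open>auto simp: A_def\<close>)
    then have "Suc (Suc (Suc (Suc (2 * d)))) \<le> N" by (rule indep_on_le)
    then show False using dim by (simp add: d_def)
  qed
  then have "minor z z' f f' = 0"
    using minor_vanishes[OF dim(1) z\<^sub>0 _ assms(3-6)] by blast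
  then show ?thesis by (simp add: minor_def)
qed

end


section \<open>Holomorphy in several variables and polarisation\<close>

lemma mv_holomorphic_on_line:
  assumes "mv_holomorphic_on f S" "\<And>t. t \<in> T \<Longrightarrow> a + t *s b \<in> S"
  shows "(\<lambda>t. f (a + t *s b)) holomorphic_on T"
  unfolding holomorphic_on_def field_differentiable_def
proof
  fix t assume "t \<in> T"
  then obtain D where D: "(f has_derivative D) (at (a + t *s b))" "\<And>c v. D (c *s v) = c * D v"
    using assms by (force simp: mv_holomorphic_on_def)
  have "((\<lambda>t. f (a + t *s b)) has_derivative (\<lambda>s. D (s *s b))) (at t within T)"
    using has_derivative_compose[OF has_derivative_line D(1)] by simp
  also have "(\<lambda>s. D (s *s b)) = (*) (D b)" by (simp add: D(2) mult.commute fun_eq_iff)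
  finally show "\<exists>f'. ((\<lambda>t. f (a + t *s b)) has_field_derivative f') (at t within T)"
    unfolding has_field_derivative_def by blast
qed

lemma mv_holomorphic_on_subset: "mv_holomorphic_on f S \<Longrightarrow> T \<subseteq> S \<Longrightarrow> mv_holomorphic_on f T"
  by (auto simp: mv_holomorphic_on_def)

lemma mv_holomorphic_on_mult:
  assumes "mv_holomorphic_on f S" "mv_holomorphic_on g S"
  shows "mv_holomorphic_on (\<lambda>z. f z * g z) S"
  unfolding mv_holomorphic_on_def
proof
  fix z assume "z \<in> S"
  with assms obtain D E where "(f has_derivative D) (at z)" "\<forall>a v. D (a *s v) = a * D v"
    "(g has_derivative E) (at z)" "\<forall>a v. E (a *s v) = a * E v"
    unfolding mv_holomorphic_on_def by metis
  then show "\<exists>D. ((\<lambda>z. f z * g z) has_derivative D) (at z) \<and> (\<forall>a v. D (a *s v) = a * D v)"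
    by (intro exI[of _ "\<lambda>h. f z * E h + D h * g z"])
      (auto intro!: derivative_eq_intros simp: algebra_simps)
qed

lemma mv_holomorphic_on_diff:
  assumes "mv_holomorphic_on f S" "mv_holomorphic_on g S"
  shows "mv_holomorphic_on (\<lambda>z. f z - g z) S"
  unfolding mv_holomorphic_on_def
proof
  fix z assume "z \<in> S"
  with assms obtain D E where "(f has_derivative D) (at z)" "\<forall>a v. D (a *s v) = a * D v"
    "(g has_derivative E) (at z)" "\<forall>a v. E (a *s v) = a * E v"
    unfolding mv_holomorphic_on_def by metis
  then show "\<exists>D. ((\<lambda>z. f z - g z) has_derivative D) (at z) \<and> (\<forall>a v. D (a *s v) = a * D v)"
    by (intro exI[of _ "\<lambda>h. D h - E h"]) (auto intro!: derivative_eq_intros simp: algebra_simps)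
qed

lemma mv_holomorphic_on_const: "mv_holomorphic_on (\<lambda>_. c) S"
  unfolding mv_holomorphic_on_def by (intro ballI exI[of _ "\<lambda>_. 0"]) auto

lemma mv_holomorphic_on_power: "mv_holomorphic_on f S \<Longrightarrow> mv_holomorphic_on (\<lambda>z. f z ^ k) S"
  by (induction k) (auto intro: mv_holomorphic_on_mult mv_holomorphic_on_const)

lemma mv_holomorphic_on_prod:
  "finite B \<Longrightarrow> (\<And>b. b \<in> B \<Longrightarrow> mv_holomorphic_on (f b) S) \<Longrightarrow> mv_holomorphic_on (\<lambda>z. \<Prod>b\<in>B. f b z) S"
  by (induction B rule: finite_induct) (auto intro: mv_holomorphic_on_mult mv_holomorphic_on_const)

lemma mv_holomorphic_on_bilin: "mv_holomorphic_on (\<lambda>z. bilin z b + c) S"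
proof -
  have "bounded_linear (\<lambda>z. bilin z b)"
    by (subst linear_conv_bounded_linear[symmetric])
      (auto intro!: linearI simp: scaleR_eq_vector_smult scaleR_conv_of_real[of _ "bilin _ _"])
  then show ?thesis
    unfolding mv_holomorphic_on_def
    by (intro ballI exI[of _ "\<lambda>h. bilin h b"])
      (auto intro!: derivative_eq_intros bounded_linear_imp_has_derivative)
qed

definition vcnj :: "complex ^ 'n::finite \<Rightarrow> complex ^ 'n" where "vcnj z = (\<chi> i. cnj (z $ i))"

lemma vcnj_nth [simp]: "vcnj z $ i = cnj (z $ i)" by (simp add: vcnj_def)

lemma vcnj_vcnj [simp]: "vcnj (vcnj z) = z"
  by (simp add: Finite_Cartesian_Product.vec_eq_iff)

lemma vcnj_add [simp]: "vcnj (a + b) = vcnj a + vcnj b"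
  by (simp add: Finite_Cartesian_Product.vec_eq_iff)

lemma vcnj_scale [simp]: "vcnj (c *s a) = cnj c *s vcnj a"
  by (simp add: Finite_Cartesian_Product.vec_eq_iff)

lemma norm_vcnj [simp]: "norm (vcnj z) = norm z"
  by (simp add: norm_vec_def)

text \<open>Conjugation in both source and target makes the derivative complex-linear again.\<close>

lemma mv_holomorphic_on_cnj:
  assumes "mv_holomorphic_on f (ball 0 R)"
  shows "mv_holomorphic_on (\<lambda>z. cnj (f (vcnj z))) (ball 0 R)"
  unfolding mv_holomorphic_on_def
proof
  fix z :: "complex ^ 'a" assume "z \<in> ball 0 R"
  then obtain D where D: "(f has_derivative D) (at (vcnj z))" "\<And>c v. D (c *s v) = c * D v"
    using assms unfolding mv_holomorphic_on_def by (metis mem_ball_0 norm_vcnj)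
  have "bounded_linear (vcnj :: complex ^ 'a \<Rightarrow> _)"
    by (subst linear_conv_bounded_linear[symmetric])
      (auto intro!: linearI simp: scaleR_eq_vector_smult)
  then have "(vcnj has_derivative vcnj) (at z)" by (rule bounded_linear_imp_has_derivative)
  then have "((\<lambda>z. f (vcnj z)) has_derivative (\<lambda>h. D (vcnj h))) (at z)"
    using D(1) by (rule has_derivative_compose)
  then have "((\<lambda>z. cnj (f (vcnj z))) has_derivative (\<lambda>h. cnj (D (vcnj h)))) (at z)"
    by (rule has_derivative_cnj)
  then show "\<exists>D. ((\<lambda>z. cnj (f (vcnj z))) has_derivative D) (at z) \<and> (\<forall>a v. D (a *s v) = a * D v)"
    by (intro exI[of _ "\<lambda>h. cnj (D (vcnj h))"]) (simp add: D(2))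
qed

text \<open>Cauchy's estimate along lines turns the majorant of the terms into one for their
  derivatives on the half ball, which allows differentiation term by term.\<close>

lemma mv_holomorphic_on_series:
  fixes f :: "nat \<Rightarrow> complex ^ 'n::finite \<Rightarrow> complex"
  assumes f: "\<And>n. mv_holomorphic_on (f n) (ball 0 r)"
    and bound: "\<And>n z. z \<in> ball 0 r \<Longrightarrow> cmod (f n z) \<le> M n" and M: "summable M"
    and g: "\<And>z. z \<in> ball 0 r \<Longrightarrow> (\<lambda>n. f n z) sums g z" and "r > 0"
  shows "mv_holomorphic_on g (ball 0 (r / 2))"
proof -
  have "\<exists>D. \<forall>n. \<forall>z\<in>ball 0 r. (f n has_derivative D n z) (at z) \<and> (\<forall>a v. D n z (a *s v) = a * D n z v)"
    using f unfolding mv_holomorphic_on_def by (intro choice allI bchoice) blast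
  then obtain D where D: "\<And>n z. z \<in> ball 0 r \<Longrightarrow> (f n has_derivative D n z) (at z)"
    and lin: "\<And>n z a v. z \<in> ball 0 r \<Longrightarrow> D n z (a *s v) = a * D n z v"
    by blast
  have D0: "D n z 0 = 0" if "z \<in> ball 0 r" for n z
    using lin[OF that, of n 0 0] by simp
  \<comment> \<open>Division by \<open>norm h\<close> makes the bound uniform in all directions h;
    at h = 0 the quotient is 0 by convention.\<close>
  have Dle: "cmod (D n z h / norm h) \<le> 4 / r * M n" if z: "z \<in> ball 0 (r / 2)" for n z h
  proof (cases "h = 0")
    case True
    have "0 \<le> M n" using bound[of 0 n] \<open>r > 0\<close> by (smt (verit) centre_in_ball norm_ge_zero)
    then show ?thesis using True \<open>r > 0\<close> by simp
  next
    case False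
    define s where "s = r / 4 / norm h"
    have "s > 0" using False \<open>r > 0\<close> by (simp add: s_def)
    have zr: "z \<in> ball 0 r" using z \<open>r > 0\<close> by simp
    define u where "u = (\<lambda>t. f n (z + t *s h))"
    have in_ball: "z + t *s h \<in> ball 0 r" if "t \<in> cball 0 s" for t
    proof -
      have "cmod t * norm h \<le> r / 4"
        using that False mult_right_mono[of "cmod t" s "norm h"] by (simp add: s_def)
      then have "norm (t *s h) \<le> r / 4" by simp
      then show ?thesis using z norm_triangle_ineq[of z "t *s h"] \<open>r > 0\<close> by simp
    qed
    have u: "u holomorphic_on cball 0 s"
      unfolding u_def using f in_ball by (rule mv_holomorphic_on_line)
    have "cmod ((deriv ^^ 1) u 0) \<le> fact 1 * M n / s ^ 1"
    proof (rule Cauchy_inequality)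
      show "u holomorphic_on ball 0 s" using u holomorphic_on_subset ball_subset_cball by blast
      show "continuous_on (cball 0 s) u" using u holomorphic_on_imp_continuous_on by blast
      show "cmod (u t) \<le> M n" if "cmod (0 - t) = s" for t
        unfolding u_def using that by (intro bound in_ball) simp
    qed (use \<open>s > 0\<close> in auto)
    moreover have "(u has_field_derivative D n z h) (at 0)"
    proof -
      have "(u has_derivative (\<lambda>t. D n z (t *s h))) (at 0)"
        unfolding u_def
        using has_derivative_compose[OF has_derivative_line[of z h 0 UNIV], of "f n" "D n z"] D[OF zr] by simp
      also have "(\<lambda>t. D n z (t *s h)) = (*) (D n z h)"
        by (simp add: lin[OF zr] mult.commute fun_eq_iff)
      finally show ?thesis by (simp add: has_field_derivative_def)
    qed
    ultimately have "cmod (D n z h) \<le> M n / s" by (simp add: DERIV_imp_deriv)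
    then show ?thesis using False \<open>r > 0\<close> by (simp add: s_def norm_divide field_simps)
  qed
  define g' where "g' = (\<lambda>z h. \<Sum>n. D n z h)"
  have summ: "summable (\<lambda>n. D n z h / norm h)" if "z \<in> ball 0 (r / 2)" for z h
    by (rule summable_comparison_test'[OF summable_mult[OF M, of "4 / r"], of 0]) (rule Dle[OF that])
  have scale: "D n z h / norm h * norm h = D n z h" if "z \<in> ball 0 (r / 2)" for n z h
    using D0[of z n] that \<open>r > 0\<close> by (cases "h = 0") auto
  have summD: "summable (\<lambda>n. D n z h)" if "z \<in> ball 0 (r / 2)" for z h
    using summable_mult2[OF summ[OF that], of h "of_real (norm h)"] scale[OF that] by simp
  have g'_scale: "(\<Sum>n. D n z h / norm h) * norm h = g' z h" if "z \<in> ball 0 (r / 2)" for z h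
    using suminf_mult2[OF summ[OF that], of h "of_real (norm h)"] scale[OF that] by (simp add: g'_def)
  have unif: "uniform_limit (ball 0 (r / 2) \<times> UNIV) (\<lambda>n x. \<Sum>i<n. D i (fst x) (snd x) / norm (snd x))
      (\<lambda>x. \<Sum>i. D i (fst x) (snd x) / norm (snd x)) sequentially"
    by (rule Weierstrass_m_test[OF _ summable_mult[OF M, of "4 / r"]]) (use Dle in auto)
  have "\<exists>g2. \<forall>x\<in>ball 0 (r / 2). (\<lambda>n. f n x) sums g2 x \<and> (g2 has_derivative g' x) (at x within ball 0 (r / 2))"
  proof (rule has_derivative_series)
    show "(f n has_derivative D n x) (at x within ball 0 (r / 2))" if "x \<in> ball 0 (r / 2)" for n x
      using D[of x n] that \<open>r > 0\<close> has_derivative_at_withinI by auto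
    show "\<forall>\<^sub>F n in sequentially. \<forall>x\<in>ball 0 (r / 2). \<forall>h. cmod ((\<Sum>i<n. D i x h) - g' x h) \<le> e * norm h"
      if "e > 0" for e
      using uniform_limitD[OF unif that]
    proof eventually_elim
      case (elim n)
      show ?case
      proof (intro ballI allI)
        fix x :: "complex ^ 'n" and h :: "complex ^ 'n"
        assume x: "x \<in> ball 0 (r / 2)"
        have "(\<Sum>i<n. D i x h) - g' x h =
            ((\<Sum>i<n. D i x h / norm h) - (\<Sum>i. D i x h / norm h)) * norm h"
          by (simp only: left_diff_distrib sum_distrib_right scale[OF x] g'_scale[OF x])
        then have "cmod ((\<Sum>i<n. D i x h) - g' x h) =
            dist (\<Sum>i<n. D i x h / norm h) (\<Sum>i. D i x h / norm h) * norm h"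
          by (simp add: norm_mult dist_norm)
        also have "\<dots> \<le> e * norm h"
          using elim x by (intro mult_right_mono) (auto intro!: less_imp_le)
        finally show "cmod ((\<Sum>i<n. D i x h) - g' x h) \<le> e * norm h" .
      qed
    qed
    show "(\<lambda>n. f n 0) sums g 0" "0 \<in> ball 0 (r / 2)" using g \<open>r > 0\<close> by auto
  qed auto
  then obtain g2 where g2: "\<And>x. x \<in> ball 0 (r / 2) \<Longrightarrow> (\<lambda>n. f n x) sums g2 x"
    "\<And>x. x \<in> ball 0 (r / 2) \<Longrightarrow> (g2 has_derivative g' x) (at x within ball 0 (r / 2))" by blast
  have eq: "g2 x = g x" if "x \<in> ball 0 (r / 2)" for x
    using sums_unique2[OF g2(1)[OF that] g[of x]] that \<open>r > 0\<close> by auto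
  show ?thesis
    unfolding mv_holomorphic_on_def
  proof (intro ballI exI conjI allI)
    fix z :: "complex ^ 'n" assume z: "z \<in> ball 0 (r / 2)"
    have "(g2 has_derivative g' z) (at z)"
      using g2(2)[OF z] z by (simp add: at_within_open[OF z])
    then show "(g has_derivative g' z) (at z)"
      by (rule has_derivative_transform_within_open[OF _ open_ball z]) (rule eq)
    show "g' z (a *s v) = a * g' z v" for a v
    proof -
      have "z \<in> ball 0 r" using z \<open>r > 0\<close> by simp
      then show ?thesis unfolding g'_def using suminf_mult[OF summD[OF z]] by (simp add: lin)
    qed
  qed
qed


text \<open>Extends the real coordinate \<open>z \<bullet> b\<close> to a bilinear function of \<open>z\<close> and \<open>w = vcnj z\<close>.\<close>

definition pcoord :: "complex ^ 'n::finite \<Rightarrow> complex ^ 'n \<Rightarrow> complex ^ 'n \<Rightarrow> complex"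
  where "pcoord b z w = (bilin z (vcnj b) + bilin w b) / 2"

lemma pcoord_vcnj: "pcoord b z (vcnj z) = complex_of_real (z \<bullet> b)"
proof -
  have "bilin z (vcnj b) + bilin (vcnj z) b = (\<Sum>i\<in>UNIV. complex_of_real (2 * (z $ i \<bullet> b $ i)))"
    unfolding bilin_def sum.distrib[symmetric]
    by (intro sum.cong) (auto simp: complex_eq_iff inner_complex_def)
  then show ?thesis
    by (simp add: pcoord_def inner_vec_def flip: sum_distrib_left)
qed

lemma cmod_bilin_le: "cmod (bilin z b) \<le> real CARD('n) * (norm z * norm b)" for z b :: "complex ^ 'n::finite"
proof -
  have "cmod (bilin z b) \<le> (\<Sum>i\<in>(UNIV :: 'n set). norm z * norm b)"
    unfolding bilin_def
    by (intro order_trans[OF norm_sum] sum_mono) (auto simp: norm_mult intro!: mult_mono Finite_Cartesian_Product.norm_nth_le)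
  then show ?thesis by simp
qed

lemma cmod_pcoord_le:
  fixes b z w :: "complex ^ 'n::finite"
  assumes "b \<in> Basis" "norm z \<le> r" "norm w \<le> r"
  shows "cmod (pcoord b z w) \<le> real CARD('n) * r"
proof -
  have "cmod (bilin z (vcnj b)) \<le> real CARD('n) * r" "cmod (bilin w b) \<le> real CARD('n) * r"
    using cmod_bilin_le[of z "vcnj b"] cmod_bilin_le[of w b] assms
    by (auto intro: order_trans mult_left_mono)
  then show ?thesis
    unfolding pcoord_def using norm_triangle_ineq[of "bilin z (vcnj b)" "bilin w b"] by (simp add: norm_divide)
qed

lemma pcoord_line: "pcoord b (x + t *s y) (x' + t *s y') = pcoord b x x' + t * pcoord b y y'"
  by (simp add: pcoord_def field_simps)

text \<open>Substitute the complexified coordinates \<open>pcoord\<close> into the real power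
  series. Its absolute convergence at one point with equal positive coordinates dominates the new
  series on a smaller ball.\<close>

lemma polarisation:
  fixes H :: "complex ^ 'n::finite \<Rightarrow> complex"
  assumes "real_analytic_near 0 H"
  obtains r G where "r > 0"
    and "\<And>z. z \<in> ball 0 r \<Longrightarrow> G z (vcnj z) = H z"
    and "\<And>a b c d. (\<lambda>t. G (a + t *s b) (c + t *s d)) holomorphic_on line_dom r a b \<inter> line_dom r c d"
    and "\<And>w. w \<in> ball 0 r \<Longrightarrow> mv_holomorphic_on (\<lambda>z. G z w) (ball 0 r)"
    and "\<And>z. z \<in> ball 0 r \<Longrightarrow> mv_holomorphic_on (\<lambda>w. G z w) (ball 0 r)"
proof -
  let ?B = "Basis :: (complex ^ 'n) set"
  define I where "I = ?B \<rightarrow>\<^sub>E (UNIV :: nat set)"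
  have "countable I" unfolding I_def by (intro countable_PiE) auto
  obtain U where "0 \<in> U" "real_analytic_on H U"
    using assms by (auto simp: real_analytic_near_def)
  then have "\<exists>c. \<exists>\<epsilon>>0. \<forall>x\<in>ball 0 \<epsilon>.
      ((\<lambda>\<alpha>. (\<Prod>b\<in>?B. ((x - 0) \<bullet> b) ^ \<alpha> b) *\<^sub>R c \<alpha>) has_sum H x) I"
    unfolding real_analytic_on_def I_def by (rule bspec[rotated])
  then obtain c \<epsilon> where "\<epsilon> > 0" and
    H: "\<And>x. x \<in> ball 0 \<epsilon> \<Longrightarrow> ((\<lambda>\<alpha>. (\<Prod>b\<in>?B. (x \<bullet> b) ^ \<alpha> b) *\<^sub>R c \<alpha>) has_sum H x) I"
    unfolding diff_zero by blast
  define K where "K = real CARD('n)"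
  have "K \<ge> 1" unfolding K_def by (simp add: Suc_leI)
  define D where "D = real (card ?B)"
  have "D > 0" by (simp add: D_def card_gt_0_iff)
  define \<rho> where "\<rho> = \<epsilon> / (2 * D)"
  have "\<rho> > 0" using \<open>\<epsilon> > 0\<close> \<open>D > 0\<close> by (simp add: \<rho>_def)
  define x\<^sub>0 where "x\<^sub>0 = (\<Sum>b\<in>?B. \<rho> *\<^sub>R b)"
  have "norm x\<^sub>0 \<le> (\<Sum>b\<in>?B. \<rho>)"
    unfolding x\<^sub>0_def using \<open>\<rho> > 0\<close> by (intro order_trans[OF norm_sum] sum_mono) auto
  also have "\<dots> = \<epsilon> / 2" using \<open>D > 0\<close> by (simp add: \<rho>_def D_def)
  finally have x\<^sub>0: "x\<^sub>0 \<in> ball 0 \<epsilon>" using \<open>\<epsilon> > 0\<close> by simp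
  define M where "M = (\<lambda>\<alpha>. (\<Prod>b\<in>?B. \<rho> ^ \<alpha> b) * cmod (c \<alpha>))"
  have "x\<^sub>0 \<bullet> b = \<rho>" if "b \<in> ?B" for b
    unfolding x\<^sub>0_def using that by (simp add: inner_sum_left inner_Basis if_distrib cong: if_cong)
  then have "((\<lambda>\<alpha>. (\<Prod>b\<in>?B. \<rho> ^ \<alpha> b) *\<^sub>R c \<alpha>) has_sum H x\<^sub>0) I"
    using H[OF x\<^sub>0] by simp
  then have "(\<lambda>\<alpha>. cmod ((\<Prod>b\<in>?B. \<rho> ^ \<alpha> b) *\<^sub>R c \<alpha>)) summable_on I"
    by (rule iffD1[OF summable_on_iff_abs_summable_on_complex has_sum_imp_summable])
  then have M: "M summable_on I"
    using \<open>\<rho> > 0\<close> by (simp add: M_def prod_nonneg)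
  \<comment> \<open>The radius is chosen so that every \<open>pcoord\<close> is at most \<rho> in
    modulus, which makes M a majorant.\<close>
  define r where "r = min \<epsilon> (\<rho> / K)"
  have r: "r > 0" "K * r \<le> \<rho>" "r \<le> \<epsilon>"
    using \<open>K \<ge> 1\<close> \<open>\<rho> > 0\<close> \<open>\<epsilon> > 0\<close> by (auto simp: r_def field_simps min_def)
  define F where "F = (\<lambda>\<alpha> z w. (\<Prod>b\<in>?B. pcoord b z w ^ \<alpha> b) * c \<alpha>)"
  define G where "G = (\<lambda>z w. \<Sum>\<^sub>\<infinity>\<alpha>\<in>I. F \<alpha> z w)"
  have FM: "cmod (F \<alpha> z w) \<le> M \<alpha>" if "z \<in> ball 0 r" "w \<in> ball 0 r" for \<alpha> z w
  proof -
    have "cmod (pcoord b z w) \<le> \<rho>" if "b \<in> ?B" for b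
      using cmod_pcoord_le[OF that, of z r w] \<open>z \<in> ball 0 r\<close> \<open>w \<in> ball 0 r\<close> r by (auto simp: K_def)
    then have "(\<Prod>b\<in>?B. cmod (pcoord b z w) ^ \<alpha> b) \<le> (\<Prod>b\<in>?B. \<rho> ^ \<alpha> b)"
      by (intro prod_mono conjI power_mono) auto
    then show ?thesis
      by (simp add: F_def M_def norm_mult norm_power mult_right_mono flip: prod_norm)
  qed
  have sumF: "((\<lambda>\<alpha>. F \<alpha> z w) has_sum G z w) I" if "z \<in> ball 0 r" "w \<in> ball 0 r" for z w
  proof -
    have "(\<lambda>\<alpha>. cmod (F \<alpha> z w)) summable_on I"
      using M FM[OF that] by (rule Infinite_Sum.abs_summable_on_comparison_test')
    then show ?thesis
      unfolding G_def by (rule has_sum_infsum[OF Infinite_Sum.abs_summable_summable])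
  qed
  \<comment> \<open>Numbers the multi-indices by naturals, as the series lemma requires; the terms
    outside J are set to 0.\<close>
  define e where "e = inv_into I (to_nat_on I)"
  have inj: "inj_on (to_nat_on I) I" using \<open>countable I\<close> by (rule inj_on_to_nat_on)
  define J where "J = to_nat_on I ` I"
  have mv: "mv_holomorphic_on g (ball 0 (r / 2))"
    if f: "\<And>\<alpha>. mv_holomorphic_on (f \<alpha>) (ball 0 r)" and fM: "\<And>\<alpha> z. z \<in> ball 0 r \<Longrightarrow> cmod (f \<alpha> z) \<le> M \<alpha>"
      and g: "\<And>z. z \<in> ball 0 r \<Longrightarrow> ((\<lambda>\<alpha>. f \<alpha> z) has_sum g z) I" for f g
  proof (rule mv_holomorphic_on_series)
    have reindex: "((\<lambda>n. if n \<in> J then h (e n) else 0) has_sum s) UNIV" if "(h has_sum s) I"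
      for h :: "(complex ^ 'n \<Rightarrow> nat) \<Rightarrow> 'c::real_normed_vector" and s
    proof -
      have "((\<lambda>n. h (e n)) has_sum s) J"
        unfolding J_def by (subst has_sum_reindex[OF inj]) (use that inj in \<open>simp add: e_def comp_def cong: has_sum_cong\<close>)
      then show ?thesis by (subst has_sum_cong_neutral[where T = J and g = "\<lambda>n. h (e n)"]) auto
    qed
    show "mv_holomorphic_on (\<lambda>z. if n \<in> J then f (e n) z else 0) (ball 0 r)" for n
      using f mv_holomorphic_on_const by (cases "n \<in> J") auto
    show "cmod (if n \<in> J then f (e n) z else 0) \<le> (if n \<in> J then M (e n) else 0)" if "z \<in> ball 0 r" for n z
      using fM[OF that] by auto
    show "summable (\<lambda>n. if n \<in> J then M (e n) else 0)"
      using has_sum_imp_sums[OF reindex[OF has_sum_infsum[OF M]]] sums_summable by blast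
    show "(\<lambda>n. if n \<in> J then f (e n) z else 0) sums g z" if "z \<in> ball 0 r" for z
      using has_sum_imp_sums[OF reindex[OF g[OF that]]] by simp
  qed fact
  have pc_left: "mv_holomorphic_on (\<lambda>z. F \<alpha> z w) S" for \<alpha> w S
  proof -
    have "pcoord b z w = bilin z ((1 / 2) *s vcnj b) + bilin w b / 2" for b z
      by (simp add: pcoord_def field_simps)
    then show ?thesis unfolding F_def
      by (intro mv_holomorphic_on_mult mv_holomorphic_on_const mv_holomorphic_on_prod mv_holomorphic_on_power)
        (simp_all add: mv_holomorphic_on_bilin del: bilin_scale)
  qed
  have pc_right: "mv_holomorphic_on (\<lambda>w. F \<alpha> z w) S" for \<alpha> z S
  proof -
    have "pcoord b z w = bilin w ((1 / 2) *s b) + bilin z (vcnj b) / 2" for b w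
      by (simp add: pcoord_def field_simps)
    then show ?thesis unfolding F_def
      by (intro mv_holomorphic_on_mult mv_holomorphic_on_const mv_holomorphic_on_prod mv_holomorphic_on_power)
        (simp_all add: mv_holomorphic_on_bilin del: bilin_scale)
  qed
  show ?thesis
  proof (rule that[of "r / 2" G])
    show "r / 2 > 0" using r by simp
    show "G z (vcnj z) = H z" if "z \<in> ball 0 (r / 2)" for z
    proof -
      have "z \<in> ball 0 \<epsilon>" using that r by auto
      from H[OF this] have "((\<lambda>\<alpha>. F \<alpha> z (vcnj z)) has_sum H z) I"
        by (simp add: F_def pcoord_vcnj scaleR_conv_of_real)
      then show ?thesis by (simp add: G_def infsumI)
    qed
    show "mv_holomorphic_on (\<lambda>z. G z w) (ball 0 (r / 2))" if "w \<in> ball 0 (r / 2)" for w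
      by (rule mv[of "\<lambda>\<alpha> z. F \<alpha> z w"]) (use that r in \<open>auto intro!: FM sumF pc_left\<close>)
    show "mv_holomorphic_on (\<lambda>w. G z w) (ball 0 (r / 2))" if "z \<in> ball 0 (r / 2)" for z
      by (rule mv[of "\<lambda>\<alpha> w. F \<alpha> z w"]) (use that r in \<open>auto intro!: FM sumF pc_right\<close>)
    show "(\<lambda>t. G (x + t *s y) (x' + t *s y')) holomorphic_on line_dom (r / 2) x y \<inter> line_dom (r / 2) x' y'"
      (is "?g holomorphic_on ?T") for x y x' y'
    proof -
      have T: "open ?T" by (intro open_Int open_line_dom)
      have local_holo: "\<exists>d>0. ?g holomorphic_on ball t d" if t: "t \<in> ?T" for t
      proof -
        obtain d where d: "d > 0" "cball t d \<subseteq> ?T"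
          using bspec[OF iffD1[OF open_contains_cball T] t] by auto
        have dom: "x + s *s y \<in> ball 0 r" "x' + s *s y' \<in> ball 0 r" if "s \<in> cball t d" for s
        proof -
          have "s \<in> ?T" using d(2) that by blast
          then show "x + s *s y \<in> ball 0 r" "x' + s *s y' \<in> ball 0 r"
            using r(1) by (auto simp: line_dom_def)
        qed
        \<comment> \<open>Along a line the partial sums are polynomials in s, and a uniform limit of
          holomorphic functions on a disc is holomorphic.\<close>
        have unif: "uniform_limit (cball t d) (\<lambda>X s. \<Sum>\<alpha>\<in>X. F \<alpha> (x + s *s y) (x' + s *s y')) ?g (finite_subsets_at_top I)"
          unfolding G_def by (rule Weierstrass_m_test_general[OF _ M]) (intro FM dom)
        have "(\<lambda>s. \<Sum>\<alpha>\<in>X. F \<alpha> (x + s *s y) (x' + s *s y')) holomorphic_on U" for X U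
          unfolding F_def pcoord_line by (intro holomorphic_intros)
        then have ev: "\<forall>\<^sub>F X in finite_subsets_at_top I.
            continuous_on (cball t d) (\<lambda>s. \<Sum>\<alpha>\<in>X. F \<alpha> (x + s *s y) (x' + s *s y')) \<and>
            (\<lambda>s. \<Sum>\<alpha>\<in>X. F \<alpha> (x + s *s y) (x' + s *s y')) holomorphic_on ball t d"
          using holomorphic_on_imp_continuous_on by (intro always_eventually) blast
        have "?g holomorphic_on ball t d"
          using holomorphic_uniform_limit[OF ev unif finite_subsets_at_top_neq_bot] by blast
        then show ?thesis using d by blast
      qed
      have diff: "?g field_differentiable (at t)" if t: "t \<in> ?T" for t
      proof -
        from local_holo[OF t] obtain d where d: "d > 0" "?g holomorphic_on ball t d"
          by (elim exE conjE)
        show ?thesis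
          by (rule holomorphic_on_imp_differentiable_at[OF d(2)]) (use d(1) in auto)
      qed
      show ?thesis
        unfolding holomorphic_on_def by (intro ballI) (rule field_differentiable_at_within[OF diff])
    qed
  qed
qed


section \<open>Absorbing the signs and factorising H\<close>

definition twist :: "('n \<Rightarrow> complex) \<Rightarrow> complex ^ 'n::finite \<Rightarrow> complex ^ 'n"
  where "twist \<sigma> z = (\<chi> i. \<sigma> i * z $ i)"

lemma twist_line: "twist \<sigma> (a + t *s b) = twist \<sigma> a + t *s twist \<sigma> b"
  by (simp add: twist_def Finite_Cartesian_Product.vec_eq_iff algebra_simps)

lemma norm_twist: "(\<And>i. cmod (\<sigma> i) = 1) \<Longrightarrow> norm (twist \<sigma> z) = norm z"
  by (simp add: twist_def norm_vec_def norm_mult)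

lemma mv_holomorphic_near_eventually:
  assumes "mv_holomorphic_near 0 f"
  shows "\<forall>\<^sub>F R in at_right 0. mv_holomorphic_on f (ball 0 R)"
proof -
  obtain U where U: "open U" "0 \<in> U" "mv_holomorphic_on f U"
    using assms by (auto simp: mv_holomorphic_near_def)
  obtain \<epsilon> where \<epsilon>: "\<epsilon> > 0" "ball 0 \<epsilon> \<subseteq> U" using openE[OF U(1,2)] by blast
  show ?thesis
    using eventually_at_right_real[OF \<epsilon>(1)]
  proof eventually_elim
    case (elim R)
    then have "ball 0 R \<subseteq> U" using \<epsilon>(2) by (auto simp: subset_eq)
    then show ?case using U(3) mv_holomorphic_on_subset by blast
  qed
qed

lemma eventually_nhds_0_imp_at_right:
  assumes "\<forall>\<^sub>F z in nhds (0 :: 'a::real_normed_vector). P z"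
  shows "\<forall>\<^sub>F R in at_right 0. \<forall>z\<in>ball 0 R. P z"
proof -
  obtain \<epsilon> where \<epsilon>: "\<epsilon> > 0" "\<And>z. dist z 0 < \<epsilon> \<Longrightarrow> P z"
    using assms by (auto simp: eventually_nhds_metric)
  show ?thesis
    using eventually_at_right_real[OF \<epsilon>(1)] by eventually_elim (use \<epsilon>(2) in auto)
qed

text \<open>
  Every pair \<open>(z, w)\<close> lies on a complex line \<open>t \<mapsto> (a + t b, vcnj a + t vcnj b)\<close>, at \<open>t = \<i>\<close>, which for
  real \<open>t\<close> stays in the set \<open>w = vcnj z\<close>.
\<close>

lemma polarised_identity:
  assumes f: "\<And>a b c d. (\<lambda>t. f (a + t *s b) (c + t *s d)) holomorphic_on line_dom R a b \<inter> line_dom R c d"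
    and 0: "\<And>z. z \<in> ball 0 R \<Longrightarrow> f z (vcnj z) = 0"
    and z: "z \<in> ball 0 R" "w \<in> ball 0 R"
  shows "f z w = 0"
proof -
  define a where "a = (1 / 2) *s (z + vcnj w)"
  define b where "b = (1 / (2 * \<i>)) *s (z - vcnj w)"
  have ab: "a + \<i> *s b = z" "vcnj a + \<i> *s vcnj b = w"
    by (simp_all add: a_def b_def Finite_Cartesian_Product.vec_eq_iff field_simps)
  define T where "T = line_dom R a b \<inter> line_dom R (vcnj a) (vcnj b)"
  have T: "open T" "connected T"
    unfolding T_def by (intro open_Int open_line_dom, intro convex_connected convex_Int convex_line_dom)
  have "norm (z + vcnj w) < 2 * R" using z norm_triangle_ineq[of z "vcnj w"] by simp
  then have "norm a < R" unfolding a_def norm_vector_smult_complex by simp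
  then have T0: "0 \<in> T" by (simp add: T_def line_dom_def)
  have Ti: "\<i> \<in> T" using z by (simp only: T_def line_dom_def mem_Collect_eq Int_iff ab)
  \<comment> \<open>The real parameters accumulate at 0, and for them the second argument is the
    conjugate of the first.\<close>
  define U where "U = {t \<in> T. Im t = 0}"
  have "f (a + \<i> *s b) (vcnj a + \<i> *s vcnj b) = 0"
  proof (rule analytic_continuation[OF f[of a b "vcnj a" "vcnj b", folded T_def] T])
    show "U \<subseteq> T" "0 \<in> T" "\<i> \<in> T" using T0 Ti by (auto simp: U_def)
    show "0 islimpt U"
      unfolding islimpt_approachable
    proof (intro allI impI)
      fix e :: real assume "e > 0"
      obtain d where d: "d > 0" "ball 0 d \<subseteq> T" using openE[OF T(1) T0] by blast
      define x where "x = min d e / 2"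
      have "x > 0" "x < d" "x < e" using d \<open>e > 0\<close> by (auto simp: x_def)
      then have "complex_of_real x \<in> U" "complex_of_real x \<noteq> 0" "dist (complex_of_real x) 0 < e"
        using d(2) by (auto simp: U_def subset_eq)
      then show "\<exists>x'\<in>U. x' \<noteq> 0 \<and> dist x' 0 < e" by blast
    qed
    show "f (a + t *s b) (vcnj a + t *s vcnj b) = 0" if "t \<in> U" for t
    proof -
      have "cnj t = t" using that by (simp add: U_def complex_eq_iff)
      then have "vcnj a + t *s vcnj b = vcnj (a + t *s b)" by simp
      then show ?thesis using 0[of "a + t *s b"] that by (simp only:) (simp add: U_def T_def line_dom_def)
    qed
  qed
  then show ?thesis unfolding ab .
qed

text \<open>Polarise the hypothesis, move the signs and the conjugations into the second variable,
  and split the polarised H by means of \<open>rank_one\<close>. The polarised identity is kept in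
  the conclusion, since the matrices are built from it.\<close>

lemma hermitian_factorisation:
  fixes \<sigma> :: "'n::finite \<Rightarrow> complex" and \<phi> \<psi> :: "nat \<Rightarrow> complex ^ 'n \<Rightarrow> complex"
  assumes \<sigma>: "\<And>i. \<sigma> i = 1 \<or> \<sigma> i = - 1"
    and \<phi>\<psi>: "\<forall>j<N. mv_holomorphic_near 0 (\<phi> j)" "\<forall>j<N. mv_holomorphic_near 0 (\<psi> j)"
    and H: "real_analytic_near 0 H" "\<not> (\<forall>\<^sub>F z in nhds 0. H z = 0)"
    and eq: "\<forall>\<^sub>F z in nhds 0. (\<Sum>j<N. \<phi> j z * cnj (\<psi> j z)) = (\<Sum>i\<in>UNIV. \<sigma> i * z $ i * cnj (z $ i)) * H z"
    and dim: "3 \<le> CARD('n)" "N + 3 \<le> 2 * CARD('n)"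
  obtains R h\<^sub>1 h\<^sub>2 z\<^sub>0 where "R > 0" "mv_holomorphic_on h\<^sub>1 (ball 0 R)" "mv_holomorphic_on h\<^sub>2 (ball 0 R)"
    "\<And>j. j < N \<Longrightarrow> mv_holomorphic_on (\<phi> j) (ball 0 R)" "\<And>j. j < N \<Longrightarrow> mv_holomorphic_on (\<psi> j) (ball 0 R)"
    "\<And>z. z \<in> ball 0 R \<Longrightarrow> H z = h\<^sub>1 z * cnj (h\<^sub>2 z)"
    "\<And>z w. z \<in> ball 0 R \<Longrightarrow> w \<in> ball 0 R \<Longrightarrow>
      (\<Sum>j<N. \<phi> j z * cnj (\<psi> j w)) = (\<Sum>i\<in>UNIV. \<sigma> i * z $ i * cnj (w $ i)) * (h\<^sub>1 z * cnj (h\<^sub>2 w))"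
    "z\<^sub>0 \<in> ball 0 R" "h\<^sub>1 z\<^sub>0 \<noteq> 0" "h\<^sub>2 z\<^sub>0 \<noteq> 0"
proof -
  obtain r G where r: "r > 0" and GH: "\<And>z. z \<in> ball 0 r \<Longrightarrow> G z (vcnj z) = H z"
    and Gline: "\<And>a b c d. (\<lambda>t. G (a + t *s b) (c + t *s d)) holomorphic_on line_dom r a b \<inter> line_dom r c d"
    and Gl: "\<And>w. w \<in> ball 0 r \<Longrightarrow> mv_holomorphic_on (\<lambda>z. G z w) (ball 0 r)"
    and Gr: "\<And>z. z \<in> ball 0 r \<Longrightarrow> mv_holomorphic_on (\<lambda>w. G z w) (ball 0 r)"
    using polarisation[OF H(1)] by blast
  have "\<forall>\<^sub>F R in at_right 0. (\<forall>j\<in>{..<N}. mv_holomorphic_on (\<phi> j) (ball 0 R)) \<and>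
      (\<forall>j\<in>{..<N}. mv_holomorphic_on (\<psi> j) (ball 0 R)) \<and>
      (\<forall>z\<in>ball 0 R. (\<Sum>j<N. \<phi> j z * cnj (\<psi> j z)) = (\<Sum>i\<in>UNIV. \<sigma> i * z $ i * cnj (z $ i)) * H z) \<and>
      R \<in> {0<..<r}"
    using \<phi>\<psi> by (intro eventually_conj eventually_ball_finite eventually_nhds_0_imp_at_right[OF eq]
      eventually_at_right_real[OF r]) (auto intro: mv_holomorphic_near_eventually)
  from eventually_happens'[OF trivial_limit_at_right_real this] obtain R
    where *: "\<forall>j\<in>{..<N}. mv_holomorphic_on (\<phi> j) (ball 0 R)"
      "\<forall>j\<in>{..<N}. mv_holomorphic_on (\<psi> j) (ball 0 R)"
      "\<forall>z\<in>ball 0 R. (\<Sum>j<N. \<phi> j z * cnj (\<psi> j z)) = (\<Sum>i\<in>UNIV. \<sigma> i * z $ i * cnj (z $ i)) * H z"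
      "R \<in> {0<..<r}"
    by (elim exE conjE)
  have hol: "mv_holomorphic_on (\<phi> j) (ball 0 R)" "mv_holomorphic_on (\<psi> j) (ball 0 R)" if "j < N" for j
    using *(1,2) that by auto
  note eqR = bspec[OF *(3)]
  have R: "R > 0" "R < r" using *(4) by auto
  have sub: "ball 0 R \<subseteq> ball (0 :: complex ^ 'n) r" "line_dom R a b \<subseteq> line_dom r a b" for a b :: "complex ^ 'n"
    using R by (auto simp: line_dom_def)
  define \<psi>' where "\<psi>' = (\<lambda>j w. cnj (\<psi> j (vcnj w)))"
  have \<psi>': "mv_holomorphic_on (\<psi>' j) (ball 0 R)" if "j < N" for j
    unfolding \<psi>'_def by (rule mv_holomorphic_on_cnj[OF hol(2)[OF that]])
  have \<sigma>1: "cmod (\<sigma> i) = 1" "\<sigma> i * \<sigma> i = 1" for i using \<sigma>[of i] by auto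
  have tw_ball: "twist \<sigma> z \<in> ball 0 R \<longleftrightarrow> z \<in> ball 0 R" for z
    by (simp add: norm_twist[OF \<sigma>1(1)])
  have tw_tw: "twist \<sigma> (twist \<sigma> z) = z" for z
    by (simp add: twist_def Finite_Cartesian_Product.vec_eq_iff \<sigma>1 flip: mult.assoc)
  have tw_dom: "line_dom R (twist \<sigma> a) (twist \<sigma> b) = line_dom R a b" for a b
    by (simp only: line_dom_def tw_ball flip: twist_line)
  have line: "(\<lambda>t. f (a + t *s b)) holomorphic_on line_dom R a b"
    if "mv_holomorphic_on f (ball 0 R)" for f a b
    using that by (rule mv_holomorphic_on_line) (simp add: line_dom_def)
  have kernel: "(\<Sum>j<N. \<phi> j z * \<psi>' j w) - bilin z (twist \<sigma> w) * G z w = 0"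
    if "z \<in> ball 0 R" "w \<in> ball 0 R" for z w
  proof (rule polarised_identity[where R = R, OF _ _ that])
    fix a b c d
    show "(\<lambda>t. (\<Sum>j<N. \<phi> j (a + t *s b) * \<psi>' j (c + t *s d))
        - bilin (a + t *s b) (twist \<sigma> (c + t *s d)) * G (a + t *s b) (c + t *s d))
        holomorphic_on line_dom R a b \<inter> line_dom R c d"
      unfolding twist_line
      by (intro holomorphic_intros holomorphic_on_subset[OF Gline] holomorphic_on_subset[OF line[OF hol(1)]]
        holomorphic_on_subset[OF line[OF \<psi>']]) (use sub in auto)
  next
    fix z :: "complex ^ 'n" assume z: "z \<in> ball 0 R"
    have "bilin z (twist \<sigma> (vcnj z)) = (\<Sum>i\<in>UNIV. \<sigma> i * z $ i * cnj (z $ i))"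
      by (simp add: bilin_def twist_def mult_ac)
    then show "(\<Sum>j<N. \<phi> j z * \<psi>' j (vcnj z)) - bilin z (twist \<sigma> (vcnj z)) * G z (vcnj z) = 0"
      using eqR[OF z] GH[of z] z sub by (auto simp: \<psi>'_def)
  qed
  \<comment> \<open>Since \<sigma> squares to 1, \<open>twist\<close> is its own inverse; it turns
    the signed pairing into \<open>bilin\<close>.\<close>
  interpret K: holomorphic_kernel R N \<phi> "\<lambda>j \<zeta>. \<psi>' j (twist \<sigma> \<zeta>)" "\<lambda>z \<zeta>. G z (twist \<sigma> \<zeta>)"
  proof
    show "R > 0" by fact
    show "(\<lambda>t. \<phi> j (a + t *s b)) holomorphic_on line_dom R a b" if "j < N" for j a b
      by (rule line[OF hol(1)[OF that]])
    show "(\<lambda>t. \<psi>' j (twist \<sigma> (a + t *s b))) holomorphic_on line_dom R a b" if "j < N" for j a b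
      using line[OF \<psi>'[OF that], of "twist \<sigma> a" "twist \<sigma> b"] by (simp only: twist_line tw_dom)
    show "(\<lambda>t. G (a + t *s b) (twist \<sigma> (c + t *s d))) holomorphic_on line_dom R a b \<inter> line_dom R c d" for a b c d
      unfolding twist_line tw_dom[of c d, symmetric]
      by (rule holomorphic_on_subset[OF Gline]) (use sub in blast)
    show "(\<Sum>j<N. \<phi> j z * \<psi>' j (twist \<sigma> \<zeta>)) = bilin z \<zeta> * G z (twist \<sigma> \<zeta>)"
      if "z \<in> ball 0 R" "\<zeta> \<in> ball 0 R" for z \<zeta>
      using kernel[of z "twist \<sigma> \<zeta>"] that by (simp only: tw_ball tw_tw) simp
  qed
  have rank1: "G z w * G z' w' = G z' w * G z w'"
    if "z \<in> ball 0 R" "z' \<in> ball 0 R" "w \<in> ball 0 R" "w' \<in> ball 0 R" for z z' w w'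
    using K.rank_one[OF dim that(1,2), of "twist \<sigma> w" "twist \<sigma> w'"] that(3,4) by (simp only: tw_ball tw_tw)
  obtain z\<^sub>0 where z0: "z\<^sub>0 \<in> ball 0 R" "H z\<^sub>0 \<noteq> 0"
  proof -
    have "\<exists>z\<in>ball 0 R. H z \<noteq> 0"
    proof (rule ccontr)
      assume "\<not> ?thesis"
      then have "\<forall>\<^sub>F z in nhds 0. H z = 0"
        unfolding eventually_nhds_metric using R(1) by (intro exI[of _ R]) (auto simp: dist_commute)
      then show False using H(2) by blast
    qed
    then show ?thesis using that by blast
  qed
  define w\<^sub>0 where "w\<^sub>0 = vcnj z\<^sub>0"
  define g where "g = G z\<^sub>0 w\<^sub>0"
  have g: "g \<noteq> 0" using z0 GH[of z\<^sub>0] sub by (auto simp: g_def w\<^sub>0_def)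
  have w0: "w\<^sub>0 \<in> ball 0 R" using z0 by (simp add: w\<^sub>0_def)
  define h\<^sub>1 where "h\<^sub>1 = (\<lambda>z. G z w\<^sub>0)"
  define h\<^sub>2 where "h\<^sub>2 = (\<lambda>w. cnj (G z\<^sub>0 (vcnj w) * inverse g))"
  \<comment> \<open>The vanishing minor against a reference point where H is nonzero separates the
    variables; the constant g is put into the second factor.\<close>
  have fac: "G z w = h\<^sub>1 z * cnj (h\<^sub>2 (vcnj w))" if "z \<in> ball 0 R" "w \<in> ball 0 R" for z w
    using rank1[OF that(1) z0(1) that(2) w0] g by (simp add: h\<^sub>1_def h\<^sub>2_def g_def[symmetric] field_simps)
  show ?thesis
  proof (rule that[of R h\<^sub>1 h\<^sub>2 z\<^sub>0])
    show "mv_holomorphic_on h\<^sub>1 (ball 0 R)"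
      unfolding h\<^sub>1_def using mv_holomorphic_on_subset[OF Gl sub(1)] w0 sub by blast
    have "mv_holomorphic_on (\<lambda>w. G z\<^sub>0 w * inverse g) (ball 0 R)"
      using mv_holomorphic_on_subset[OF Gr sub(1)] z0 sub
      by (intro mv_holomorphic_on_mult mv_holomorphic_on_const) blast
    then show "mv_holomorphic_on h\<^sub>2 (ball 0 R)"
      unfolding h\<^sub>2_def by (rule mv_holomorphic_on_cnj)
    show "H z = h\<^sub>1 z * cnj (h\<^sub>2 z)" if "z \<in> ball 0 R" for z
      using fac[of z "vcnj z"] GH[of z] that sub by auto
    show "(\<Sum>j<N. \<phi> j z * cnj (\<psi> j w)) = (\<Sum>i\<in>UNIV. \<sigma> i * z $ i * cnj (w $ i)) * (h\<^sub>1 z * cnj (h\<^sub>2 w))"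
      if "z \<in> ball 0 R" "w \<in> ball 0 R" for z w
    proof -
      have "bilin z (twist \<sigma> (vcnj w)) = (\<Sum>i\<in>UNIV. \<sigma> i * z $ i * cnj (w $ i))"
        by (simp add: bilin_def twist_def mult_ac)
      then show ?thesis
        using kernel[of z "vcnj w"] fac[of z "vcnj w"] that by (simp add: \<psi>'_def)
    qed
    show "h\<^sub>1 z\<^sub>0 \<noteq> 0" "h\<^sub>2 z\<^sub>0 \<noteq> 0"
      using g by (simp_all add: h\<^sub>1_def h\<^sub>2_def g_def w\<^sub>0_def)
  qed (use hol R z0 in auto)
qed


section \<open>Linear algebra of the factorised kernel\<close>

lemma closed_under_sum:
  fixes V :: "(nat \<Rightarrow> 'a::field) \<Rightarrow> bool"
  assumes add: "\<And>y y'. V y \<Longrightarrow> V y' \<Longrightarrow> V (\<lambda>j. y j + y' j)" and scale: "\<And>c y. V y \<Longrightarrow> V (\<lambda>j. c * y j)"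
    and "finite K" "V y" "\<And>k. k \<in> K \<Longrightarrow> V (b k)"
  shows "V (\<lambda>j. y j + (\<Sum>k\<in>K. c k * b k j))"
  using assms(3,5)
proof (induction K rule: finite_induct)
  case empty
  then show ?case using assms(4) by simp
next
  case (insert k K)
  have "V (\<lambda>j. (y j + (\<Sum>k\<in>K. c k * b k j)) + c k * b k j)"
    by (rule add[OF insert.IH scale]) (use insert.prems in auto)
  then show ?case using insert by (simp add: add_ac)
qed

text \<open>The index set J consists of pivots. In reduced form the coefficients of y are its own
  entries at the pivots, so they are holomorphic whenever y depends holomorphically on z.\<close>

lemma reduced_echelon_basis:
  fixes V :: "(nat \<Rightarrow> 'a::field) \<Rightarrow> bool"
  assumes "\<And>y y'. V y \<Longrightarrow> V y' \<Longrightarrow> V (\<lambda>j. y j + y' j)" "\<And>c y. V y \<Longrightarrow> V (\<lambda>j. c * y j)"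
  shows "\<exists>J\<subseteq>{..<n}. \<exists>b. (\<forall>j\<in>J. V (b j) \<and> (\<forall>k\<in>J. b j k = (if k = j then 1 else 0))) \<and>
    (\<forall>y. V y \<longrightarrow> (\<forall>i<n. y i = (\<Sum>j\<in>J. y j * b j i)))"
  using assms
proof (induction n arbitrary: V)
  case 0
  then show ?case by (intro exI[of _ "{}"]) auto
next
  case (Suc n)
  define W where "W = (\<lambda>y. V y \<and> y n = 0)"
  have "\<exists>J\<subseteq>{..<n}. \<exists>b. (\<forall>j\<in>J. W (b j) \<and> (\<forall>k\<in>J. b j k = (if k = j then 1 else 0))) \<and>
    (\<forall>y. W y \<longrightarrow> (\<forall>i<n. y i = (\<Sum>j\<in>J. y j * b j i)))"
    by (rule Suc.IH) (use Suc.prems in \<open>auto simp: W_def\<close>)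
  then obtain J b where J: "J \<subseteq> {..<n}"
    and *: "\<forall>j\<in>J. W (b j) \<and> (\<forall>k\<in>J. b j k = (if k = j then 1 else 0))"
      "\<forall>y. W y \<longrightarrow> (\<forall>i<n. y i = (\<Sum>j\<in>J. y j * b j i))"
    by (elim exE conjE)
  have bW: "W (b j)" if "j \<in> J" for j using *(1) that by blast
  have bk: "b j k = (if k = j then 1 else 0)" if "j \<in> J" "k \<in> J" for j k using *(1) that by blast
  have rep: "y i = (\<Sum>j\<in>J. y j * b j i)" if "W y" "i < n" for y i
    using *(2)[rule_format, OF that] .
  have fin: "finite J" using J finite_subset by blast
  have bn: "b j n = 0" "V (b j)" if "j \<in> J" for j using bW[OF that] by (auto simp: W_def)
  have repW: "y i = (\<Sum>j\<in>J. y j * b j i)" if "W y" "i < Suc n" for y i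
  proof (cases "i = n")
    case True
    then show ?thesis using that(1) bn by (simp add: W_def)
  qed (use rep that in auto)
  show ?case
  proof (cases "\<exists>y. V y \<and> y n \<noteq> 0")
    case False
    then have VW: "V y \<Longrightarrow> W y" for y by (auto simp: W_def)
    show ?thesis
      by (rule exI[of _ J], intro conjI exI[of _ b]) (use J bn bk repW VW in auto)
  next
    case True
    then obtain y\<^sub>1 where y1: "V y\<^sub>1" "y\<^sub>1 n \<noteq> 0" by blast
    define y\<^sub>2 where "y\<^sub>2 = (\<lambda>j. 1 / y\<^sub>1 n * y\<^sub>1 j)"
    \<comment> \<open>The new basis vector, normalised to 1 at the pivot n, is cleared at the
      earlier pivots.\<close>
    define y\<^sub>0 where "y\<^sub>0 = (\<lambda>i. y\<^sub>2 i + (\<Sum>j\<in>J. - y\<^sub>2 j * b j i))"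
    have "V y\<^sub>2" unfolding y\<^sub>2_def by (rule Suc.prems(2)[OF y1(1)])
    then have V0: "V y\<^sub>0"
      unfolding y\<^sub>0_def by (intro closed_under_sum[where V = V] Suc.prems fin bn)
    have y0n: "y\<^sub>0 n = 1" using y1(2) bn by (simp add: y\<^sub>0_def y\<^sub>2_def)
    have y0J: "y\<^sub>0 k = 0" if "k \<in> J" for k
    proof -
      have "(\<Sum>j\<in>J. - y\<^sub>2 j * b j k) = (\<Sum>j\<in>J. if j = k then - y\<^sub>2 j else 0)"
        by (intro sum.cong) (use bk that in auto)
      then show ?thesis using that fin by (simp add: y\<^sub>0_def)
    qed
    have nJ: "n \<notin> J" using J by auto
    define b' where "b' = b(n := y\<^sub>0)"
    have b': "b' n = y\<^sub>0" "j \<in> J \<Longrightarrow> b' j = b j" for j using nJ by (auto simp: b'_def)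
    have rep': "y i = (\<Sum>j\<in>insert n J. y j * b' j i)" if "V y" "i < Suc n" for y i
    proof -
      define x where "x = (\<lambda>j. y j + (- y n) * y\<^sub>0 j)"
      have "V x" unfolding x_def by (rule Suc.prems(1)[OF that(1) Suc.prems(2)[OF V0]])
      then have "W x" by (simp add: W_def x_def y0n)
      from repW[OF this that(2)] have "x i = (\<Sum>j\<in>J. x j * b j i)" .
      also have "\<dots> = (\<Sum>j\<in>J. y j * b' j i)"
        by (intro sum.cong) (simp_all add: x_def y0J b')
      finally have "y i = y n * y\<^sub>0 i + (\<Sum>j\<in>J. y j * b' j i)" by (simp add: x_def algebra_simps)
      then show ?thesis using fin nJ by (simp add: b')
    qed
    show ?thesis
    proof (intro exI[of _ "insert n J"] conjI exI[of _ b'] ballI allI impI)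
      show "insert n J \<subseteq> {..<Suc n}" using J by auto
      show "V (b' j)" if "j \<in> insert n J" for j using that V0 bn b' by auto
      show "b' j k = (if k = j then 1 else 0)" if "j \<in> insert n J" "k \<in> insert n J" for j k
        using that bk bn y0n y0J b' nJ by auto
      show "y i = (\<Sum>j\<in>insert n J. y j * b' j i)" if "V y" "i < Suc n" for y i by (rule rep'[OF that])
    qed
  qed
qed

section \<open>Lifts of vectors and adapted columns\<close>

definition lin_rel :: "(complex ^ 'n::finite \<Rightarrow> (nat \<Rightarrow> complex) \<Rightarrow> bool) \<Rightarrow> bool"
  where "lin_rel V \<longleftrightarrow>
    (\<forall>x x' y y'. V x y \<longrightarrow> V x' y' \<longrightarrow> V (x + x') (\<lambda>j. y j + y' j)) \<and>
    (\<forall>c x y. V x y \<longrightarrow> V (c *s x) (\<lambda>j. c * y j))"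

lemma lin_rel_add: "lin_rel V \<Longrightarrow> V x y \<Longrightarrow> V x' y' \<Longrightarrow> V (x + x') (\<lambda>j. y j + y' j)"
  unfolding lin_rel_def by blast

lemma lin_rel_scale: "lin_rel V \<Longrightarrow> V x y \<Longrightarrow> V (c *s x) (\<lambda>j. c * y j)"
  unfolding lin_rel_def by blast

text \<open>Wherever h is nonzero, z itself has a lift. For a suitable t this applies to a base
  point and to its translate by t x, and x is their difference divided by t.\<close>

lemma exists_lift:
  fixes V :: "complex ^ 'n::finite \<Rightarrow> (nat \<Rightarrow> complex) \<Rightarrow> bool"
  assumes V: "lin_rel V"
    and h: "mv_holomorphic_on h (ball 0 R)" "z\<^sub>0 \<in> ball 0 R" "h z\<^sub>0 \<noteq> 0"
    and F: "\<forall>z\<in>ball 0 R. V (h z *s z) (\<lambda>j. F j z)"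
  shows "\<exists>y. V x y"
proof -
  note add = lin_rel_add[OF V] and scale = lin_rel_scale[OF V]
  have hol: "(\<lambda>t. h (z\<^sub>0 + t *s x)) holomorphic_on line_dom R z\<^sub>0 x"
    using h(1) by (rule mv_holomorphic_on_line) (simp add: line_dom_def)
  obtain t where t: "t \<in> line_dom R z\<^sub>0 x" "t \<noteq> 0" "h (z\<^sub>0 + t *s x) \<noteq> 0"
    using line_nonzero_near[OF hol, of 0 0 1] h(2,3) by (auto simp: line_dom_def)
  have ex: "\<exists>y. V z y" if "z \<in> ball 0 R" "h z \<noteq> 0" for z
    using scale[OF bspec[OF F that(1)], of "1 / h z"] that(2) by auto
  have "z\<^sub>0 + t *s x \<in> ball 0 R" using t(1) by (simp add: line_dom_def)
  then obtain y y' where "V z\<^sub>0 y" "V (z\<^sub>0 + t *s x) y'"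
    using ex h(2,3) t(3) by blast
  from scale[OF add[OF this(2) scale[OF this(1), of "- 1"]], of "1 / t"]
  have "\<exists>y. V ((1 / t) *s (z\<^sub>0 + t *s x + (- 1) *s z\<^sub>0)) y" by blast
  also have "(1 / t) *s (z\<^sub>0 + t *s x + (- 1) *s z\<^sub>0) = x"
    using t(2) by (simp add: Finite_Cartesian_Product.vec_eq_iff)
  finally show ?thesis .
qed

lemma sum_basis_axis:
  assumes "bij_betw e {..<m} (UNIV :: 'n::finite set)"
  shows "(\<Sum>i\<in>UNIV. f i) = (\<Sum>k<m. f (e k))"
  by (rule sum.reindex_bij_betw[OF assms, symmetric])

lemma sum_axis_axis:
  assumes "bij_betw e {..<m} (UNIV :: 'n::finite set)" "k < m" "l < m"
  shows "(\<Sum>i\<in>UNIV. \<sigma> i * axis (e k) 1 $ i * cnj (axis (e l) 1 $ i)) = (if k = l then \<sigma> (e k) else (0 :: complex))"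
proof -
  have "e k = e l \<longleftrightarrow> k = l" using assms by (auto simp: bij_betw_def inj_on_def)
  moreover have "(\<Sum>i\<in>UNIV. \<sigma> i * axis (e k) 1 $ i * cnj (axis (e l) 1 $ i)) =
      (\<Sum>i\<in>UNIV. if i = e k then (if e k = e l then \<sigma> i else 0) else 0)"
    by (intro sum.cong) (auto simp: axis_def)
  ultimately show ?thesis by simp
qed

text \<open>
  \<open>V x y\<close> reads "\<open>y\<close> is a lift of \<open>x\<close>": the columns are lifts of the standard basis followed by a spanning
  family, padded by zeros, of the lifts of \<open>0\<close>, whose coefficients are entries \<open>y (g l)\<close> of the vector itself.
\<close>

lemma adapted_columns:
  fixes V V' :: "complex ^ 'n::finite \<Rightarrow> (nat \<Rightarrow> complex) \<Rightarrow> bool"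
  assumes e: "bij_betw e {..<m} (UNIV :: 'n set)" and \<sigma>: "\<And>i. \<sigma> i \<noteq> 0"
    and V: "lin_rel V"
    and lift: "\<forall>x. \<exists>y. V x y" "\<forall>x. \<exists>y. V' x y"
    and pairing: "\<forall>x y x' y'. V x y \<longrightarrow> V' x' y' \<longrightarrow>
      (\<Sum>j<m + q. y j * cnj (y' j)) = (\<Sum>i\<in>UNIV. \<sigma> i * x $ i * cnj (x' $ i))"
  obtains col g p where "p \<le> q" "\<forall>l<p. g l < m + q"
    "\<forall>k<m. V (axis (e k) 1) (col k)" "\<forall>l<q. V 0 (col (m + l))"
    "\<forall>y. V 0 y \<longrightarrow> (\<forall>i<m + q. y i = (\<Sum>l<p. y (g l) * col (m + l) i))"
proof -
  note add = lin_rel_add[OF V] and scale = lin_rel_scale[OF V] and pair = pairing[rule_format]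
  define n where "n = m + q"
  define b where "b = (\<lambda>k. SOME y. V (axis (e k) 1) y)"
  define c where "c = (\<lambda>k. SOME y. V' (axis (e k) 1) y)"
  have b: "V (axis (e k) 1) (b k)" and c: "V' (axis (e k) 1) (c k)" for k
    unfolding b_def c_def using someI_ex[OF spec[OF lift(1)]] someI_ex[OF spec[OF lift(2)]] by blast+
  have add0: "V 0 (\<lambda>j. y j + y' j)" if "V 0 y" "V 0 y'" for y y' using add[OF that] by simp
  have scale0: "V 0 (\<lambda>j. a * y j)" if "V 0 y" for y a using scale[OF that, of a] by simp
  have "\<exists>J\<subseteq>{..<n}. \<exists>d. (\<forall>j\<in>J. V 0 (d j) \<and> (\<forall>k\<in>J. d j k = (if k = j then 1 else 0))) \<and>
      (\<forall>y. V 0 y \<longrightarrow> (\<forall>i<n. y i = (\<Sum>j\<in>J. y j * d j i)))"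
    by (rule reduced_echelon_basis) (rule add0 scale0; assumption)+
  then obtain J d where J: "J \<subseteq> {..<n}"
    and *: "\<forall>j\<in>J. V 0 (d j) \<and> (\<forall>k\<in>J. d j k = (if k = j then 1 else 0))"
      "\<forall>y. V 0 y \<longrightarrow> (\<forall>i<n. y i = (\<Sum>j\<in>J. y j * d j i))"
    by (elim exE conjE)
  have dV: "V 0 (d j)" if "j \<in> J" for j using *(1) that by blast
  have dk: "d j k = (if k = j then 1 else 0)" if "j \<in> J" "k \<in> J" for j k using *(1) that by blast
  have rep: "y i = (\<Sum>j\<in>J. y j * d j i)" if "V 0 y" "i < n" for y i
    using *(2)[rule_format, OF that] .
  have fin: "finite J" using J finite_subset by blast
  define p where "p = card J"
  obtain g where g: "bij_betw g {..<p} J"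
    using ex_bij_betw_nat_finite[OF fin] by (auto simp: p_def atLeast0LessThan)
  have gJ: "g l \<in> J" if "l < p" for l using g that by (auto simp: bij_betw_def)
  have gn: "g l < n" if "l < p" for l using gJ[OF that] J by auto
  define u where "u = (\<lambda>i. if i < m then b i else d (g (i - m)))"
  have pair_u: "(\<Sum>j<n. u i j * cnj (c l j)) = (if i = l then \<sigma> (e l) else 0)" if "i < m + p" "l < m" for i l
  proof (cases "i < m")
    case True
    then show ?thesis
      using pair[OF b[of i] c[of l]] sum_axis_axis[OF e True that(2), of \<sigma>] by (simp add: u_def n_def)
  next
    case False
    then have "g (i - m) \<in> J" using gJ[of "i - m"] that by simp
    then show ?thesis
      using pair[OF dV c[of l], of "g (i - m)"] False that(2) by (simp add: u_def n_def)
  qed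
  \<comment> \<open>The m + p vectors \<open>u\<close> are independent in n coordinates: pairing
    with the \<open>c l\<close> isolates the first m coefficients, and the entries at the pivots
    \<open>g l\<close> isolate the others.\<close>
  have "p \<le> q"
  proof (rule ccontr)
    assume "\<not> p \<le> q"
    then have "n < m + p" by (simp add: n_def)
    from overdetermined_dependent[OF this, of u] obtain \<beta> where \<beta>: "\<exists>i<m + p. \<beta> i \<noteq> 0"
      and dep: "\<And>j. j < n \<Longrightarrow> (\<Sum>i<m + p. \<beta> i * u i j) = 0" by blast
    have \<beta>0: "\<beta> l = 0" if "l < m" for l
    proof -
      have "0 = (\<Sum>j<n. (\<Sum>i<m + p. \<beta> i * u i j) * cnj (c l j))" using dep by simp
      also have "\<dots> = (\<Sum>i<m + p. \<beta> i * (\<Sum>j<n. u i j * cnj (c l j)))"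
        unfolding sum_distrib_left sum_distrib_right by (subst sum.swap) (simp add: mult.assoc)
      also have "\<dots> = (\<Sum>i<m + p. if i = l then \<beta> i * \<sigma> (e l) else 0)"
        by (intro sum.cong) (auto simp: pair_u that)
      also have "\<dots> = \<beta> l * \<sigma> (e l)" using that by simp
      finally show ?thesis using \<sigma> by simp
    qed
    have "\<beta> (m + l) = 0" if "l < p" for l
    proof -
      have "0 = (\<Sum>i<m + p. \<beta> i * u i (g l))" using dep[OF gn[OF that]] by simp
      also have "\<dots> = (\<Sum>i<m + p. if i = m + l then \<beta> i else 0)"
      proof (intro sum.cong refl)
        fix i assume i: "i \<in> {..<m + p}"
        show "\<beta> i * u i (g l) = (if i = m + l then \<beta> i else 0)"
        proof (cases "i < m")
          case False
          then have im: "i - m < p" using i by auto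
          have "g l = g (i - m) \<longleftrightarrow> l = i - m"
            using g im that by (auto simp: bij_betw_def inj_on_def)
          then have "d (g (i - m)) (g l) = (if l = i - m then 1 else 0)"
            using dk[OF gJ[OF im] gJ[OF that]] by simp
          then show ?thesis using False by (auto simp: u_def)
        qed (use \<beta>0 in auto)
      qed
      also have "\<dots> = \<beta> (m + l)" using that by simp
      finally show ?thesis by simp
    qed
    then have "\<beta> i = 0" if "i < m + p" for i
      using \<beta>0[of i] that by (metis add_diff_inverse_nat add_less_cancel_left)
    then show False using \<beta> by blast
  qed
  define col where "col = (\<lambda>i. if i < m + p then u i else (\<lambda>_. 0))"
  show ?thesis
  proof (rule that[of p g col])
    show "p \<le> q" by fact
    show "\<forall>l<p. g l < m + q" using gn by (simp add: n_def)
    show "\<forall>k<m. V (axis (e k) 1) (col k)" using b by (simp add: col_def u_def)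
    obtain y where "V 0 y" using lift(1) by blast
    then have "V 0 (\<lambda>_. 0)" using scale0[of y 0] by simp
    then show "\<forall>l<q. V 0 (col (m + l))" using dV gJ by (auto simp: col_def u_def)
    show "\<forall>y. V 0 y \<longrightarrow> (\<forall>i<m + q. y i = (\<Sum>l<p. y (g l) * col (m + l) i))"
    proof (intro allI impI)
      fix y i assume that: "V 0 y" "i < m + q"
      have "y i = (\<Sum>j\<in>J. y j * d j i)" using rep[OF that(1)] that(2) by (simp add: n_def)
      also have "\<dots> = (\<Sum>l<p. y (g l) * d (g l) i)" by (rule sum.reindex_bij_betw[OF g, symmetric])
      also have "\<dots> = (\<Sum>l<p. y (g l) * col (m + l) i)"
        by (intro sum.cong) (auto simp: col_def u_def)
      finally show "y i = (\<Sum>l<p. y (g l) * col (m + l) i)" .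
    qed
  qed
qed


lemma lift_sum:
  fixes V :: "complex ^ 'n::finite \<Rightarrow> (nat \<Rightarrow> complex) \<Rightarrow> bool" and m :: nat
  assumes V: "lin_rel V"
    and "V x y" "\<forall>k<m. V (a k) (b k)"
  shows "V (x + (\<Sum>k<m. c k *s a k)) (\<lambda>j. y j + (\<Sum>k<m. c k * b k j))"
  using assms(3)
proof (induction m)
  case 0
  then show ?case using assms(2) by simp
next
  case (Suc m)
  have "V ((x + (\<Sum>k<m. c k *s a k)) + c m *s a m) (\<lambda>j. (y j + (\<Sum>k<m. c k * b k j)) + c m * b m j)"
    by (rule lin_rel_add[OF V Suc.IH lin_rel_scale[OF V]]) (use Suc.prems in auto)
  then show ?case by (simp add: add.assoc)
qed

lemma sum_lessThan_add: "(\<Sum>k<m + q. f k) = (\<Sum>k<m. f k) + (\<Sum>l<q. f (m + l))"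
  for f :: "nat \<Rightarrow> 'a::comm_monoid_add"
  by (induction q) (simp_all add: add.assoc)

text \<open>The vector F(z) minus the combination of the first m columns with coefficients h(z) z_k
  is a lift of 0, hence a combination of the remaining columns.\<close>

lemma column_representation:
  fixes V :: "complex ^ 'n::finite \<Rightarrow> (nat \<Rightarrow> complex) \<Rightarrow> bool" and col :: "nat \<Rightarrow> nat \<Rightarrow> complex"
  assumes e: "bij_betw e {..<m} (UNIV :: 'n set)"
    and V: "lin_rel V"
    and col: "p \<le> q" "\<forall>l<p. g l < m + q" "\<forall>k<m. V (axis (e k) 1) (col k)"
      "\<forall>y. V 0 y \<longrightarrow> (\<forall>i<m + q. y i = (\<Sum>l<p. y (g l) * col (m + l) i))"
    and "R > 0" and h: "mv_holomorphic_on h (ball 0 R)"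
    and F: "\<forall>j<m + q. mv_holomorphic_on (F j) (ball 0 R)"
    and VF: "\<forall>z\<in>ball 0 R. V (h z *s z) (\<lambda>j. F j z)"
  obtains \<Phi> where "\<And>l. mv_holomorphic_near 0 (\<Phi> l)"
    "\<And>z. z \<in> ball 0 R \<Longrightarrow> Matrix.vec (m + q) (\<lambda>j. F j z) =
      mat (m + q) (m + q) (\<lambda>(i, k). col k i) *\<^sub>v stacked_vec e m q h \<Phi> z"
proof -
  define d where "d = (\<lambda>l. \<chi> i. col (inv_into {..<m} e i) (g l))"
  have bilin_d: "bilin z (d l) = (\<Sum>k<m. z $ e k * col k (g l))" for z l
    unfolding bilin_def sum_basis_axis[OF e] d_def
    using e by (intro sum.cong) (auto simp: bij_betw_def)
  \<comment> \<open>The entry at pivot \<open>g l\<close> of the lift of 0 that remains; for the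
    zero columns used as padding the coefficient is set to 0.\<close>
  define \<Phi> where "\<Phi> = (\<lambda>l z. if l < p then F (g l) z - h z * bilin z (d l) else 0)"
  have near: "mv_holomorphic_near 0 (\<Phi> l)" for l
  proof -
    have "mv_holomorphic_on (\<lambda>z. bilin z (d l)) (ball 0 R)"
      using mv_holomorphic_on_bilin[of "d l" 0] by simp
    then have "mv_holomorphic_on (\<Phi> l) (ball 0 R)"
      unfolding \<Phi>_def using h F col(2)
      by (cases "l < p") (auto intro: mv_holomorphic_on_diff mv_holomorphic_on_mult mv_holomorphic_on_const)
    then show ?thesis
      unfolding mv_holomorphic_near_def using \<open>R > 0\<close> by (intro exI[of _ "ball 0 R"]) auto
  qed
  have rep: "F i z = (\<Sum>k<m. h z * z $ e k * col k i) + (\<Sum>l<q. \<Phi> l z * col (m + l) i)"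
    if z: "z \<in> ball 0 R" and i: "i < m + q" for z i
  proof -
    define y where "y = (\<lambda>j. F j z + (\<Sum>k<m. - (h z * z $ e k) * col k j))"
    have "h z *s z + (\<Sum>k<m. - (h z * z $ e k) *s axis (e k) 1) = 0"
    proof -
      have "(\<Sum>k<m. - (h z * z $ e k) *s axis (e k) 1) $ i = - (h z * z $ i)" for i
      proof -
        have "(\<Sum>k<m. - (h z * z $ e k) *s axis (e k) 1) $ i = (\<Sum>k<m. - (h z * z $ e k) * (axis (e k) 1 $ i))"
          by (simp add: sum_component)
        also have "\<dots> = (\<Sum>j\<in>UNIV. - (h z * z $ j) * (axis j 1 $ i))"
          by (rule sum_basis_axis[OF e, symmetric])
        also have "\<dots> = (\<Sum>j\<in>UNIV. if j = i then - (h z * z $ j) else 0)"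
          by (intro sum.cong) (auto simp: axis_def)
        finally show ?thesis by simp
      qed
      then show ?thesis by (simp add: Finite_Cartesian_Product.vec_eq_iff)
    qed
    then have "V 0 y"
      unfolding y_def
      using lift_sum[of V "h z *s z" "\<lambda>j. F j z" m "\<lambda>k. axis (e k) 1" col "\<lambda>k. - (h z * z $ e k)",
          OF V bspec[OF VF z] col(3)]
      by simp
    with col(4) i have "y i = (\<Sum>l<p. y (g l) * col (m + l) i)" by blast
    also have "\<dots> = (\<Sum>l<p. \<Phi> l z * col (m + l) i)"
      by (intro sum.cong)
        (auto simp: y_def \<Phi>_def bilin_d sum_negf sum_distrib_left mult.assoc)
    also have "\<dots> = (\<Sum>l<q. \<Phi> l z * col (m + l) i)"
      by (rule sum.mono_neutral_left) (use col(1) in \<open>auto simp: \<Phi>_def\<close>)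
    finally show ?thesis by (simp add: y_def sum_negf algebra_simps)
  qed
  show ?thesis
  proof (rule that[of \<Phi>, OF near])
    fix z :: "complex ^ 'n" assume z: "z \<in> ball 0 R"
    show "Matrix.vec (m + q) (\<lambda>j. F j z) =
      mat (m + q) (m + q) (\<lambda>(i, k). col k i) *\<^sub>v stacked_vec e m q h \<Phi> z"
    proof (rule eq_vecI)
      fix i assume "i < dim_vec (mat (m + q) (m + q) (\<lambda>(i, k). col k i) *\<^sub>v stacked_vec e m q h \<Phi> z)"
      then have i: "i < m + q" by simp
      have "vec_index (mat (m + q) (m + q) (\<lambda>(i, k). col k i) *\<^sub>v stacked_vec e m q h \<Phi> z) i =
          (\<Sum>k<m + q. col k i * (if k < m then h z * z $ e k else \<Phi> (k - m) z))"
        using i by (simp add: stacked_vec_def scalar_prod_def atLeast0LessThan)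
      also have "\<dots> = F i z"
        unfolding rep[OF z i] sum_lessThan_add by (simp add: mult.commute)
      finally show "vec_index (Matrix.vec (m + q) (\<lambda>j. F j z)) i =
          vec_index (mat (m + q) (m + q) (\<lambda>(i, k). col k i) *\<^sub>v stacked_vec e m q h \<Phi> z) i"
        using i by simp
    qed simp
  qed
qed

section \<open>Assembling the theorem\<close>

lemma sq_norm_rs_eq_sum:
  fixes e :: "nat \<Rightarrow> 'n::finite"
  assumes "bij_betw e {..<r + s} UNIV"
  defines "\<sigma> \<equiv> \<lambda>i. if inv_into {..<r + s} e i < r then 1 else - 1"
  shows "complex_of_real (sq_norm_rs e r s z) = (\<Sum>i\<in>UNIV. \<sigma> i * z $ i * cnj (z $ i))"
proof -
  have "(\<Sum>i\<in>UNIV. \<sigma> i * z $ i * cnj (z $ i)) =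
      (\<Sum>k<r + s. (if k < r then 1 else - 1) * complex_of_real ((cmod (z $ e k))\<^sup>2))"
    unfolding sum_basis_axis[OF assms(1)] \<sigma>_def using assms(1)
    by (intro sum.cong) (auto simp: bij_betw_def simp flip: complex_norm_square)
  also have "\<dots> = (\<Sum>k<r. complex_of_real ((cmod (z $ e k))\<^sup>2)) - (\<Sum>l<s. complex_of_real ((cmod (z $ e (r + l)))\<^sup>2))"
    unfolding sum_lessThan_add by (simp add: sum_negf)
  also have "(\<Sum>l<s. complex_of_real ((cmod (z $ e (r + l)))\<^sup>2)) = (\<Sum>j = r..<r + s. complex_of_real ((cmod (z $ e j))\<^sup>2))"
    by (rule sum.reindex_bij_witness[of _ "\<lambda>j. j - r" "\<lambda>l. r + l"]) auto
  finally show ?thesis by (simp add: sq_norm_rs_def)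
qed

theorem theorem1p1:
  fixes r s n' :: nat
    and e :: "nat \<Rightarrow> 'n::finite"
    and \<phi> \<psi> :: "nat \<Rightarrow> complex ^ 'n \<Rightarrow> complex"
    and H :: "complex ^ 'n \<Rightarrow> complex"
  assumes "bij_betw e {..<r + s} UNIV"
    and "\<forall>j<n'. mv_holomorphic_near 0 (\<phi> j)"
    and "\<forall>j<n'. mv_holomorphic_near 0 (\<psi> j)"
    and "real_analytic_near 0 H"
    and "\<forall>\<^sub>F z in nhds 0. (\<Sum>j<n'. \<phi> j z * cnj (\<psi> j z)) = complex_of_real (sq_norm_rs e r s z) * H z"
    and "r + s \<le> n'"
    and "int n' \<le> 2 * (int r + int s) - 3"
    and "\<not> (\<forall>\<^sub>F z in nhds 0. H z = 0)"
  shows "\<exists>h\<^sub>1 h\<^sub>2. mv_holomorphic_near 0 h\<^sub>1 \<and> mv_holomorphic_near 0 h\<^sub>2 \<and>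
    (\<forall>\<^sub>F z in nhds 0. H z = h\<^sub>1 z * cnj (h\<^sub>2 z)) \<and>
    (let q = n' - r - s in
      \<exists>\<Phi> \<Psi>. \<exists>B \<in> carrier_mat n' n'. \<exists>C \<in> carrier_mat n' n'.
        (\<forall>i<q. mv_holomorphic_near 0 (\<Phi> i)) \<and> (\<forall>i<q. mv_holomorphic_near 0 (\<Psi> i)) \<and>
        transpose_mat (map_mat cnj C) * B = H_mat r s q \<and>
        (\<forall>\<^sub>F z in nhds 0. Matrix.vec n' (\<lambda>j. \<phi> j z) = B *\<^sub>v stacked_vec e (r + s) q h\<^sub>1 \<Phi> z) \<and>
        (\<forall>\<^sub>F z in nhds 0. Matrix.vec n' (\<lambda>j. \<psi> j z) = C *\<^sub>v stacked_vec e (r + s) q h\<^sub>2 \<Psi> z))"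
proof -
  define m where "m = r + s"
  define q where "q = n' - r - s"
  have n': "n' = m + q" using assms(6) by (simp add: m_def q_def)
  note e = assms(1)[folded m_def]
  have card: "CARD('n) = m" using bij_betw_same_card[OF e] by simp
  \<comment> \<open>The two bounds on n' together force r + s to be at least 3.\<close>
  have dim: "3 \<le> CARD('n)" "n' + 3 \<le> 2 * CARD('n)"
    using assms(6,7) by (simp_all add: card m_def)
  define \<sigma> :: "'n \<Rightarrow> complex" where "\<sigma> = (\<lambda>i. if inv_into {..<m} e i < r then 1 else - 1)"
  have \<sigma>: "\<sigma> i = 1 \<or> \<sigma> i = - 1" "\<sigma> i \<noteq> 0" "cnj (\<sigma> i) = \<sigma> i" for i by (auto simp: \<sigma>_def)
  have \<sigma>e: "\<sigma> (e k) = (if k < r then 1 else - 1)" if "k < m" for k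
    using e that by (simp add: \<sigma>_def bij_betw_def)
  have eq: "\<forall>\<^sub>F z in nhds 0. (\<Sum>j<n'. \<phi> j z * cnj (\<psi> j z)) = (\<Sum>i\<in>UNIV. \<sigma> i * z $ i * cnj (z $ i)) * H z"
    using assms(5) unfolding sq_norm_rs_eq_sum[OF assms(1)] \<sigma>_def m_def .
  obtain R h\<^sub>1 h\<^sub>2 z\<^sub>0 where R: "R > 0"
    and h: "mv_holomorphic_on h\<^sub>1 (ball 0 R)" "mv_holomorphic_on h\<^sub>2 (ball 0 R)"
    and hol: "\<And>j. j < n' \<Longrightarrow> mv_holomorphic_on (\<phi> j) (ball 0 R)" "\<And>j. j < n' \<Longrightarrow> mv_holomorphic_on (\<psi> j) (ball 0 R)"
    and Hh: "\<And>z. z \<in> ball 0 R \<Longrightarrow> H z = h\<^sub>1 z * cnj (h\<^sub>2 z)"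
    and pol: "\<And>z w. z \<in> ball 0 R \<Longrightarrow> w \<in> ball 0 R \<Longrightarrow>
      (\<Sum>j<n'. \<phi> j z * cnj (\<psi> j w)) = (\<Sum>i\<in>UNIV. \<sigma> i * z $ i * cnj (w $ i)) * (h\<^sub>1 z * cnj (h\<^sub>2 w))"
    and z0: "z\<^sub>0 \<in> ball 0 R" "h\<^sub>1 z\<^sub>0 \<noteq> 0" "h\<^sub>2 z\<^sub>0 \<noteq> 0"
    using hermitian_factorisation[OF \<sigma>(1) assms(2,3,4,8) eq dim] by blast
  \<comment> \<open>A lift y of x pairs with every \<psi>(w) as x pairs, with signs, with the second
    factor of H times w. By the polarised identity \<phi>(z) is such a lift.\<close>
  define V where "V = (\<lambda>(x :: complex ^ 'n) y. \<forall>w\<in>ball 0 R.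
    (\<Sum>j<n'. y j * cnj (\<psi> j w)) = (\<Sum>i\<in>UNIV. \<sigma> i * x $ i * cnj (w $ i)) * cnj (h\<^sub>2 w))"
  \<comment> \<open>Defined by duality with V, so that every V-lift and every V'-lift pair as the
    vectors below them do. That \<psi>(z) is a V'-lift is the definition of V read
    backwards.\<close>
  define V' where "V' = (\<lambda>(x' :: complex ^ 'n) y'. \<forall>x y. V x y \<longrightarrow>
    (\<Sum>j<n'. y j * cnj (y' j)) = (\<Sum>i\<in>UNIV. \<sigma> i * x $ i * cnj (x' $ i)))"
  have add: "V (x + x') (\<lambda>j. y j + y' j)" if "V x y" "V x' y'" for x x' y y'
    using that by (simp add: V_def algebra_simps sum.distrib)
  have scale: "V (c *s x) (\<lambda>j. c * y j)" if "V x y" for c x y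
  proof -
    have "(\<Sum>j<n'. c * y j * cnj (\<psi> j w)) = c * (\<Sum>j<n'. y j * cnj (\<psi> j w))"
      "(\<Sum>i\<in>UNIV. \<sigma> i * (c *s x) $ i * cnj (w $ i)) = c * (\<Sum>i\<in>UNIV. \<sigma> i * x $ i * cnj (w $ i))" for w
      by (simp_all add: sum_distrib_left mult_ac)
    then show ?thesis using that unfolding V_def by (simp only:) (simp add: mult.assoc)
  qed
  have add': "V' (x + x') (\<lambda>j. y j + y' j)" if "V' x y" "V' x' y'" for x x' y y'
    using that by (simp add: V'_def algebra_simps sum.distrib)
  have scale': "V' (c *s x) (\<lambda>j. c * y j)" if "V' x y" for c x y
  proof -
    have "(\<Sum>j<n'. v j * cnj (c * y j)) = cnj c * (\<Sum>j<n'. v j * cnj (y j))"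
      "(\<Sum>i\<in>UNIV. \<sigma> i * u $ i * cnj ((c *s x) $ i)) = cnj c * (\<Sum>i\<in>UNIV. \<sigma> i * u $ i * cnj (x $ i))" for u v
      by (simp_all add: sum_distrib_left mult_ac)
    then show ?thesis using that unfolding V'_def by (simp only:) simp
  qed
  have lin: "lin_rel V" "lin_rel V'"
    unfolding lin_rel_def by (intro conjI allI impI add scale add' scale'; assumption)+
  have V\<phi>: "\<forall>z\<in>ball 0 R. V (h\<^sub>1 z *s z) (\<lambda>j. \<phi> j z)"
    unfolding V_def using pol by (simp add: sum_distrib_left sum_distrib_right mult_ac)
  have V\<psi>: "\<forall>z\<in>ball 0 R. V' (h\<^sub>2 z *s z) (\<lambda>j. \<psi> j z)"
    unfolding V'_def by (auto simp: V_def sum_distrib_left sum_distrib_right mult_ac)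
  have pair: "(\<Sum>j<m + q. y j * cnj (y' j)) = (\<Sum>i\<in>UNIV. \<sigma> i * x $ i * cnj (x' $ i))"
    if "V x y" "V' x' y'" for x y x' y'
    using that unfolding V'_def n' by blast
  have pair': "(\<Sum>j<m + q. y' j * cnj (y j)) = (\<Sum>i\<in>UNIV. \<sigma> i * x' $ i * cnj (x $ i))"
    if "V' x' y'" "V x y" for x y x' y'
    using arg_cong[OF pair[OF that(2,1)], of cnj] by (simp add: \<sigma>(3) mult_ac)
  have pairs: "\<forall>x y x' y'. V x y \<longrightarrow> V' x' y' \<longrightarrow>
      (\<Sum>j<m + q. y j * cnj (y' j)) = (\<Sum>i\<in>UNIV. \<sigma> i * x $ i * cnj (x' $ i))"
    "\<forall>x y x' y'. V' x y \<longrightarrow> V x' y' \<longrightarrow>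
      (\<Sum>j<m + q. y j * cnj (y' j)) = (\<Sum>i\<in>UNIV. \<sigma> i * x $ i * cnj (x' $ i))"
    by (intro allI impI pair pair'; assumption)+
  have lift: "\<forall>x. \<exists>y. V x y" "\<forall>x. \<exists>y. V' x y"
    using exists_lift[OF lin(1) h(1) z0(1,2) V\<phi>] exists_lift[OF lin(2) h(2) z0(1,3) V\<psi>] by blast+
  obtain b gb pb where b: "pb \<le> q" "\<forall>l<pb. gb l < m + q"
    "\<forall>k<m. V (axis (e k) 1) (b k)" "\<forall>l<q. V 0 (b (m + l))"
    "\<forall>y. V 0 y \<longrightarrow> (\<forall>i<m + q. y i = (\<Sum>l<pb. y (gb l) * b (m + l) i))"
    using adapted_columns[OF e \<sigma>(2) lin(1) lift pairs(1)] .
  obtain c gc pc where c: "pc \<le> q" "\<forall>l<pc. gc l < m + q"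
    "\<forall>k<m. V' (axis (e k) 1) (c k)" "\<forall>l<q. V' 0 (c (m + l))"
    "\<forall>y. V' 0 y \<longrightarrow> (\<forall>i<m + q. y i = (\<Sum>l<pc. y (gc l) * c (m + l) i))"
    using adapted_columns[OF e \<sigma>(2) lin(2) lift(2,1) pairs(2)] .
  define B where "B = mat n' n' (\<lambda>(i, k). b k i)"
  define C where "C = mat n' n' (\<lambda>(i, k). c k i)"
  have hol': "\<forall>j<m + q. mv_holomorphic_on (\<phi> j) (ball 0 R)" "\<forall>j<m + q. mv_holomorphic_on (\<psi> j) (ball 0 R)"
    using hol n' by blast+
  obtain \<Phi> where \<Phi>: "\<And>l. mv_holomorphic_near 0 (\<Phi> l)"
    "\<And>z. z \<in> ball 0 R \<Longrightarrow> Matrix.vec n' (\<lambda>j. \<phi> j z) = B *\<^sub>v stacked_vec e m q h\<^sub>1 \<Phi> z"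
    using column_representation[OF e lin(1) b(1,2,3,5) R h(1) hol'(1) V\<phi>] unfolding B_def n' by blast
  obtain \<Psi> where \<Psi>: "\<And>l. mv_holomorphic_near 0 (\<Psi> l)"
    "\<And>z. z \<in> ball 0 R \<Longrightarrow> Matrix.vec n' (\<lambda>j. \<psi> j z) = C *\<^sub>v stacked_vec e m q h\<^sub>2 \<Psi> z"
    using column_representation[OF e lin(2) c(1,2,3,5) R h(2) hol'(2) V\<psi>] unfolding C_def n' by blast
  have CB: "transpose_mat (map_mat cnj C) * B = H_mat r s q"
  proof (rule eq_matI)
    fix i k assume "i < dim_row (H_mat r s q)" "k < dim_col (H_mat r s q)"
    then have ik: "i < m + q" "k < m + q" by (auto simp: H_mat_def m_def)
    \<comment> \<open>The entries of the product are the pairings of the columns, which are lifts of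
      standard basis vectors or of 0.\<close>
    have "(transpose_mat (map_mat cnj C) * B) $$ (i, k) = (\<Sum>j<m + q. b k j * cnj (c i j))"
      using ik by (simp add: B_def C_def n' scalar_prod_def atLeast0LessThan mult.commute)
    also have "\<dots> = (if i = k \<and> k < m then \<sigma> (e k) else 0)"
    proof -
      have Vb: "V (if k < m then axis (e k) 1 else 0) (b k)"
        using b(3) b(4)[rule_format, of "k - m"] ik(2) by auto
      have Vc: "V' (if i < m then axis (e i) 1 else 0) (c i)"
        using c(3) c(4)[rule_format, of "i - m"] ik(1) by auto
      show ?thesis
        unfolding pair[OF Vb Vc] using sum_axis_axis[OF e, of k i \<sigma>] by auto
    qed
    also have "\<dots> = H_mat r s q $$ (i, k)"
      using ik \<sigma>e by (auto simp: H_mat_def m_def)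
    finally show "(transpose_mat (map_mat cnj C) * B) $$ (i, k) = H_mat r s q $$ (i, k)" .
  qed (simp_all add: B_def C_def H_mat_def n' m_def)
  have ball: "\<forall>\<^sub>F z in nhds 0. P z" if "\<And>z. z \<in> ball 0 R \<Longrightarrow> P z" for P :: "complex ^ 'n \<Rightarrow> bool"
    unfolding eventually_nhds by (rule exI[of _ "ball 0 R"]) (use that R in auto)
  have near: "mv_holomorphic_near 0 f" if "mv_holomorphic_on f (ball 0 R)" for f :: "complex ^ 'n \<Rightarrow> complex"
    using that R unfolding mv_holomorphic_near_def by (intro exI[of _ "ball 0 R"]) auto
  have carrier: "B \<in> carrier_mat n' n'" "C \<in> carrier_mat n' n'" by (simp_all add: B_def C_def)
  have ev: "\<forall>\<^sub>F z in nhds 0. H z = h\<^sub>1 z * cnj (h\<^sub>2 z)"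
    "\<forall>\<^sub>F z in nhds 0. Matrix.vec n' (\<lambda>j. \<phi> j z) = B *\<^sub>v stacked_vec e m q h\<^sub>1 \<Phi> z"
    "\<forall>\<^sub>F z in nhds 0. Matrix.vec n' (\<lambda>j. \<psi> j z) = C *\<^sub>v stacked_vec e m q h\<^sub>2 \<Psi> z"
    by (rule ball, erule Hh \<Phi>(2) \<Psi>(2))+
  show ?thesis
    unfolding Let_def q_def[symmetric] m_def[symmetric]
  proof (rule exI[of _ h\<^sub>1], rule exI[of _ h\<^sub>2], intro conjI)
    show "mv_holomorphic_near 0 h\<^sub>1" "mv_holomorphic_near 0 h\<^sub>2" by (rule near, rule h)+
    show "\<exists>\<Phi> \<Psi>. \<exists>B \<in> carrier_mat n' n'. \<exists>C \<in> carrier_mat n' n'.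
        (\<forall>i<q. mv_holomorphic_near 0 (\<Phi> i)) \<and> (\<forall>i<q. mv_holomorphic_near 0 (\<Psi> i)) \<and>
        transpose_mat (map_mat cnj C) * B = H_mat r s q \<and>
        (\<forall>\<^sub>F z in nhds 0. Matrix.vec n' (\<lambda>j. \<phi> j z) = B *\<^sub>v stacked_vec e m q h\<^sub>1 \<Phi> z) \<and>
        (\<forall>\<^sub>F z in nhds 0. Matrix.vec n' (\<lambda>j. \<psi> j z) = C *\<^sub>v stacked_vec e m q h\<^sub>2 \<Psi> z)"
      by (rule exI[of _ \<Phi>], rule exI[of _ \<Psi>], rule bexI[OF _ carrier(1)], rule bexI[OF _ carrier(2)])
        (intro conjI allI impI \<Phi>(1) \<Psi>(1) CB ev)
  qed (rule ev)
qed

end
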